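(* Let $(d_n,k_n)_{n\geq 1}$ be a sequence of pairs of positive integers satisfying $k_n < d_n$, $2k_n > d_n+1$ and $d_n \to \infty$ as $n\to\infty$. Write $Z^*_n := Z_{d_n,k_n}/\sigma_{d_n,k_n}$ for the variance normalized version of $Z_{d_n,k_n}$ and abbreviate $r_n := 2k_n - d_n - 1$. (a) If $k_n/d_n \to 1/2$ and $\limsup_{n\to \infty} d_n^{-1} \, r_n^{d_n/k_n} < e\pi$, then $Z^*_n$ converges in distribution to a standard Gaussian law. (b) If $k_n/d_n \to 1/2$ and $\liminf_{n\to \infty} d_n^{-1} \, r_n^{d_n/k_n} > e\pi$, or if $\liminf_{n \to \infty}k_n/d_n > 1/2$, then $Z^*_n$ converges in distribution to $0$.
   Context: For integers $d,k$ with $1\le k\le d-1$ and $2k>d+1$, $Z_{d,k}$ denotes a real random variable with characteristic function $$\varphi_{Z_{d,k}}(t) = \exp\Big( \int_{\mathbb{R}} (e^{itx}-1-itx) \,\nu_{d,k}(\mathrm{d} x) \Big), \quad t \in \mathbb{R},$$ where the Lévy measure $\nu_{d,k}$ is $$\nu_{d,k}(\mathrm{d} x)=\frac{\omega_{d-k}}{k-1}\;x^{-1-\frac{d-1}{k-1}}\bigl(1-x^{\frac{2}{k-1}}\bigr)^{\frac{d-k}{2}-1}\,\mathbf 1_{(0,1)}(x)\,\mathrm{d} x,$$ and $\omega_b=2\pi^{b/2}/\Gamma(b/2)$ for $b\in\mathbb{N}$. The variance of $Z_{d,k}$ is $\sigma_{d,k}^2 := \mathbb{V}(Z_{d,k})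 = \int_{\mathbb{R}} x^2\,\nu_{d,k}(\mathrm{d} x)$, which is finite (and positive); $\sigma_{d,k}>0$ denotes its square root. Here $e$ is Euler's number. *)

theory Defs
  imports "HOL-Probability.Probability"
begin

text \<open>\<open>sphere_area b\<close> is the surface area of the unit sphere in \<open>b\<close>-dimensional Euclidean space.\<close>

definition sphere_area :: "nat \<Rightarrow> real" where
  "sphere_area b = 2 * pi powr (real b / 2) / Gamma (real b / 2)"

text \<open>The parameters are meant to satisfy \<open>1 \<le> k < d\<close> and \<open>2 * k > d + 1\<close> (hence \<open>k \<ge> 3\<close>).
  The total mass is then infinite, but the second moment is finite.\<close>

definition levy_density :: "nat \<Rightarrow> nat \<Rightarrow> real \<Rightarrow> real" where
  "levy_density d k x =
     sphere_area (d - k) / (real k - 1)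
       * x powr (- 1 - (real d - 1) / (real k - 1))
       * (1 - x powr (2 / (real k - 1))) powr ((real d - real k) / 2 - 1)
       * indicator {0<..<1} x"

definition levy_measure :: "nat \<Rightarrow> nat \<Rightarrow> real measure" where
  "levy_measure d k = density lborel (\<lambda>x. ennreal (levy_density d k x))"

text \<open>\<open>is_Z M Z d k\<close>: on the probability space \<open>M\<close>, the random variable \<open>Z\<close> has the
  infinitely divisible law with characteristic exponent given by \<open>levy_measure d k\<close>.
  The characteristic function determines the law, but neither \<open>M\<close> nor \<open>Z\<close>.\<close>

definition is_Z :: "'a measure \<Rightarrow> ('a \<Rightarrow> real) \<Rightarrow> nat \<Rightarrow> nat \<Rightarrow> bool" where
  "is_Z M Z d k \<longleftrightarrow>
     prob_space M \<and> Z \<in> borel_measurable M \<and>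
     (\<forall>t::real. char (distr M borel Z) t =
        exp (\<integral>x. (exp (\<i> * complex_of_real (t * x)) - 1 - \<i> * complex_of_real (t * x))
               \<partial>levy_measure d k))"

definition variance_normalized :: "'a measure \<Rightarrow> ('a \<Rightarrow> real) \<Rightarrow> 'a \<Rightarrow> real" where
  "variance_normalized M Z = (\<lambda>\<omega>. Z \<omega> / sqrt (prob_space.variance M Z))"

text \<open>The random variables may live on different probability spaces; the limit is given by its law.\<close>

definition converges_in_distribution ::
    "(nat \<Rightarrow> 'a measure) \<Rightarrow> (nat \<Rightarrow> 'a \<Rightarrow> real) \<Rightarrow> real measure \<Rightarrow> bool" where
  "converges_in_distribution M X L \<longleftrightarrow> weak_conv_m (\<lambda>n. distr (M n) borel (X n)) L"

end

theory Submission
  imports Defs "HOL-Real_Asymp.Real_Asymp"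
begin

text \<open>
  Fix \<open>d\<close> and \<open>k\<close> and write \<open>m = k - 1\<close>, \<open>r = 2 k - d - 1\<close>, \<open>s = d - k\<close>, so that \<open>m = r + s\<close>. Let \<open>v\<close>
  be the second moment of the Levy measure \<open>\<nu>\<close>. Then \<open>\<mu>(dx) = x\<^sup>2 \<nu>(dx) / v\<close> is a probability
  measure on the unit interval, and the characteristic exponent of \<open>Z / sqrt v\<close> at \<open>t\<close> is the
  \<open>\<mu>\<close>-integral of \<open>K t (x / sqrt v)\<close> with \<open>K t x = (exp (i t x) - 1 - i t x) / x\<^sup>2\<close>. This kernel is
  bounded, tends to \<open>- t\<^sup>2 / 2\<close> as \<open>x\<close> tends to \<open>0\<close>, and tends to \<open>0\<close> as \<open>x\<close> tends to infinity. By
  Levy's continuity theorem the limit is therefore Gaussian if \<open>x / sqrt v\<close> tends to \<open>0\<close> in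
  \<open>\<mu>\<close>-probability (\<open>levy_kernel_gaussian_limit\<close>), and it is \<open>0\<close> if \<open>x / sqrt v\<close> tends to infinity in
  \<open>\<mu>\<close>-probability (\<open>levy_kernel_degenerate_limit\<close>). That the variance of \<open>Z\<close> is \<open>v\<close> has to be read
  off from the characteristic function near \<open>0\<close> (\<open>variance_Z\<close>).

  Under \<open>\<mu>\<close> the variable \<open>Y = x powr (2 / m)\<close> has the Beta law with parameters \<open>r / 2\<close> and \<open>s / 2\<close>
  (\<open>size_biased_moment\<close>), so everything reduces to comparing \<open>Y\<close> with the thresholds
  \<open>(c v) powr (1 / m)\<close> for constants \<open>c > 0\<close>. The mean of \<open>Y\<close> is \<open>r / m\<close> and its variance is at most
  \<open>2 r / m\<^sup>2\<close>. Let \<open>w\<close> be the quotient of the threshold and the mean. Since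
  \<open>v = pi powr (s / 2) * Gamma (r / 2) / Gamma (m / 2)\<close>, Stirling's estimate shows, when \<open>k / d\<close> tends
  to \<open>1 / 2\<close>, that \<open>2 ln w\<close> equals \<open>ln (e pi) - ln (r powr (d / k) / d)\<close> up to a null sequence
  (\<open>log_threshold_approx\<close>): this is the origin of the constant \<open>e pi\<close>. Chebyshev's inequality bounds
  the mass on the far side of the threshold by \<open>2 / (r (w - 1)\<^sup>2)\<close>. If \<open>w\<close> stays below \<open>1\<close>, then \<open>r\<close>
  tends to infinity and the bound vanishes. If \<open>w\<close> stays above \<open>1\<close>, then \<open>r\<close> may be bounded, but the
  bound is still of order \<open>1 / (r w\<^sup>2)\<close>, hence at most of order \<open>r / d\<close>.

  If \<open>k / d\<close> stays above \<open>1 / 2\<close>, then \<open>s\<close> may be bounded; in that case \<open>1 - Y\<close> is typically of order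
  \<open>1 / m\<close>, which is too fine for the estimates above. Here Markov's inequality is applied to \<open>1 / Y - 1\<close>,
  whose mean is \<open>s / (r - 2)\<close>, and logarithmic convexity of the Gamma function gives
  \<open>v \<le> (2 pi / (r - 2)) powr (s / 2)\<close>, a bound that is sharp enough even for \<open>s = 1\<close>
  (\<open>ln_levy_variance_le\<close>, \<open>size_biased_lower_tail\<close>).
\<close>

section \<open>The size-biased Levy measure and the Beta distribution\<close>

definition excess :: "nat \<Rightarrow> nat \<Rightarrow> real" where
  "excess d k = 2 * real k - real d - 1"

text \<open>The closed form of the second moment of the Levy measure; that it is the second moment is the
  total mass statement \<open>prob_space_size_biased\<close>.\<close>

definition levy_variance :: "nat \<Rightarrow> nat \<Rightarrow> real" where
  "levy_variance d k =
     pi powr ((real d - real k) / 2) * Gamma (excess d k / 2) / Gamma ((real k - 1) / 2)"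

definition admissible :: "nat \<Rightarrow> nat \<Rightarrow> bool" where
  "admissible d k \<longleftrightarrow> k < d \<and> d + 1 < 2 * k"

lemma admissibleD:
  assumes "admissible d k"
  shows "real k \<ge> 3" "real d - real k \<ge> 1" "excess d k \<ge> 1" "excess d k + (real d - real k) = real k - 1"
  using assms by (auto simp: admissible_def excess_def)

lemma levy_variance_pos: "admissible d k \<Longrightarrow> levy_variance d k > 0"
  using admissibleD[of d k] by (auto simp: levy_variance_def)

lemma borel_measurable_levy_density [measurable]: "levy_density d k \<in> borel_measurable borel"
  unfolding levy_density_def by measurable

lemma levy_density_nonneg:
  assumes "admissible d k" shows "levy_density d k x \<ge> 0"
proof -
  have "sphere_area (d - k) \<ge> 0"
    using assms by (auto simp: sphere_area_def admissible_def)
  moreover have "real k - 1 \<ge> 0" using admissibleD(1)[OF assms] by simp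
  ultimately show ?thesis by (auto simp: levy_density_def indicator_def)
qed

lemma levy_density_eq_0: "x \<notin> {0<..<1} \<Longrightarrow> levy_density d k x = 0"
  by (simp add: levy_density_def)

text \<open>The substitution \<open>y = x powr (2 / (k - 1))\<close> turns the Levy density into a Beta density.\<close>

lemma levy_density_moment:
  assumes adm: "admissible d k" and p: "p > (real d - 1) / (real k - 1)"
  shows "has_bochner_integral lborel (\<lambda>x. x powr p * levy_density d k x)
           (pi powr ((real d - real k) / 2) / Gamma ((real d - real k) / 2) *
            Beta (((real k - 1) * p - (real d - 1)) / 2) ((real d - real k) / 2))"
proof -
  define m where "m = real k - 1"
  define s where "s = (real d - real k) / 2"
  define A where "A = (m * p - (real d - 1)) / 2"
  define f where "f = (\<lambda>y. y powr (A - 1) * (1 - y) powr (s - 1))"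
  define g where "g = (\<lambda>x. x powr (2 / m))"
  define g' where "g' = (\<lambda>x. (2 / m) * x powr (2 / m - 1))"
  have m: "m \<ge> 2" and s: "s > 0"
    using admissibleD[OF adm] by (auto simp: m_def s_def)
  have A: "A > 0" using p m by (simp add: A_def field_simps m_def)
  have gS: "g ` {0<..<1} = {0<..<1}"
  proof (intro equalityI subsetI)
    fix y assume "y \<in> g ` {0<..<1}"
    then show "y \<in> {0<..<1}" using m by (auto simp: g_def intro: powr_less_mono2[of "2 / m" _ 1, simplified])
  next
    fix y :: real assume y: "y \<in> {0<..<1}"
    have "g (y powr (m / 2)) = y" using y m by (simp add: g_def powr_powr)
    moreover have "y powr (m / 2) \<in> {0<..<1}" using y m by (auto intro: powr_less_mono2[of "m / 2" y 1, simplified])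
    ultimately show "y \<in> g ` {0<..<1}" by (metis imageI)
  qed
  have der: "(g has_field_derivative g' x) (at x within {0<..<1})" if "x \<in> {0<..<1}" for x
    unfolding g_def g'_def using that
    by (auto intro!: derivative_eq_intros simp: powr_diff field_simps)
  have inj: "inj_on g {0<..<1}"
    unfolding g_def using m by (intro inj_onI) (auto dest: arg_cong[where f = "\<lambda>y. y powr (m / 2)"] simp: powr_powr)
  have f_int: "(f has_integral Beta A s) {0<..<1}"
    using has_integral_Beta_real[OF A s] by (simp add: has_integral_Icc_iff_Ioo f_def)
  have "f absolutely_integrable_on {0<..<1}"
    using f_int by (intro nonnegative_absolutely_integrable_1) (auto simp: f_def has_integral_integrable)
  moreover have "integral {0<..<1} f = Beta A s" using f_int by (rule integral_unique)
  ultimately have *: "(\<lambda>x. \<bar>g' x\<bar> * f (g x)) absolutely_integrable_on {0<..<1} \<and>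
     integral {0<..<1} (\<lambda>x. \<bar>g' x\<bar> * f (g x)) = Beta A s"
    using has_absolute_integral_change_of_variables_1'[of "{0<..<1}" g g' f "Beta A s"] der inj gS by auto
  define h where "h = (\<lambda>x. indicator {0<..<1} x * (\<bar>g' x\<bar> * f (g x)))"
  have h_meas [measurable]: "h \<in> borel_measurable borel"
    unfolding h_def f_def g_def g'_def by measurable
  have "integrable lebesgue h"
    using * by (simp add: set_integrable_def h_def)
  then have 1: "integrable lborel h" by (simp add: integrable_completion)
  have "integral\<^sup>L lborel h = (LINT x:{0<..<1}|lborel. \<bar>g' x\<bar> * f (g x))"
    by (simp add: h_def set_lebesgue_integral_def)
  also have "\<dots> = Beta A s"
    using * 1 set_borel_integral_eq_integral(2)[of "{0<..<1}" "\<lambda>x. \<bar>g' x\<bar> * f (g x)"]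
    by (simp add: set_integrable_def h_def)
  finally have h: "has_bochner_integral lborel h (Beta A s)"
    using 1 by (simp add: has_bochner_integral_iff)
  have "x powr p * levy_density d k x = pi powr s / Gamma s * h x" for x
  proof (cases "x \<in> {0<..<1}")
    case True
    have "x powr (2 / m - 1) * x powr ((2 / m) * (A - 1)) = x powr (p + (- 1 - (real d - 1) / m))"
    proof -
      have "2 / m - 1 + 2 / m * (A - 1) = p + (- 1 - (real d - 1) / m)"
        using m by (simp add: A_def field_simps)
      then show ?thesis by (metis powr_add)
    qed
    moreover have "\<bar>g' x\<bar> = (2 / m) * x powr (2 / m - 1)" using m by (simp add: g'_def)
    moreover have "f (g x) = x powr ((2 / m) * (A - 1)) * (1 - x powr (2 / m)) powr (s - 1)"
      using True by (simp add: f_def g_def powr_powr)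
    ultimately have "h x = (2 / m) * (x powr (p + (- 1 - (real d - 1) / m)) * (1 - x powr (2 / m)) powr (s - 1))"
      using True by (simp add: h_def mult.assoc)
    moreover have "sphere_area (d - k) = 2 * pi powr s / Gamma s"
      using adm by (simp add: sphere_area_def s_def admissible_def of_nat_diff)
    ultimately show ?thesis
      using True by (simp add: levy_density_def powr_add m_def[symmetric] s_def[symmetric])
  qed (simp add: levy_density_eq_0 h_def)
  then show ?thesis
    using has_bochner_integral_mult_right[OF h, of "pi powr s / Gamma s"]
    by (simp add: A_def s_def m_def)
qed

text \<open>Weighting by \<open>x\<^sup>2\<close> makes the singularity of the Levy density at \<open>0\<close> integrable; this is where
  \<open>2 k > d + 1\<close> enters.\<close>

definition size_biased :: "nat \<Rightarrow> nat \<Rightarrow> real measure" where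
  "size_biased d k = density lborel (\<lambda>x. ennreal (x\<^sup>2 * levy_density d k x / levy_variance d k))"

lemma sets_size_biased [measurable_cong, simp]: "sets (size_biased d k) = sets borel"
  by (simp add: size_biased_def)

lemma space_size_biased [simp]: "space (size_biased d k) = UNIV"
  by (simp add: size_biased_def)

lemma size_biased_density_nonneg:
  "admissible d k \<Longrightarrow> x\<^sup>2 * levy_density d k x / levy_variance d k \<ge> 0"
  using levy_density_nonneg levy_variance_pos by (auto intro!: divide_nonneg_pos)

lemma integral_size_biased:
  fixes F :: "real \<Rightarrow> 'b :: {banach, second_countable_topology}"
  assumes "admissible d k" "F \<in> borel_measurable borel"
  shows "integral\<^sup>L (size_biased d k) F =
    (\<integral>x. (x\<^sup>2 * levy_density d k x / levy_variance d k) *\<^sub>R F x \<partial>lborel)"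
  unfolding size_biased_def using assms size_biased_density_nonneg
  by (intro integral_density) auto

lemma size_biased_AE: "AE x in size_biased d k. x \<in> {0<..<1}"
proof -
  have *: "x \<in> {0<..<1}" if "ennreal (x\<^sup>2 * levy_density d k x / levy_variance d k) > 0" for x
    using that levy_density_eq_0[of x d k] by (cases "x \<in> {0<..<1}") auto
  show ?thesis
    unfolding size_biased_def
    by (subst AE_density, measurable) (rule AE_I2, rule impI, rule *)
qed

text \<open>These are the moments of the Beta law with parameters \<open>excess d k / 2\<close> and \<open>(d - k) / 2\<close>, that is,
  the law of \<open>x powr (2 / (k - 1))\<close> under the size-biased measure. Negative \<open>j\<close> is needed for the
  mean of the reciprocal.\<close>

lemma size_biased_moment:
  assumes adm: "admissible d k" and j: "j > - excess d k / 2"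
  defines "s \<equiv> (real d - real k) / 2"
  shows "has_bochner_integral (size_biased d k) (\<lambda>x. x powr (2 * j / (real k - 1)))
           (Beta (excess d k / 2 + j) s / Beta (excess d k / 2) s)"
proof -
  define m where "m = real k - 1"
  define p where "p = 2 + 2 * j / m"
  define r where "r = excess d k"
  note A = admissibleD[OF adm]
  have m: "m \<ge> 2" and s: "s > 0" and r: "r \<ge> 1" and rs: "r / 2 + s = m / 2"
    using A by (auto simp: m_def s_def r_def field_simps)
  have mp: "(m * p - (real d - 1)) / 2 = r / 2 + j"
    using m by (simp add: p_def r_def field_simps excess_def m_def)
  have "m * p - (real d - 1) > 0" using j mp by (simp add: r_def)
  then have "p > (real d - 1) / m" using m by (simp add: field_simps)
  from levy_density_moment[OF adm this[unfolded m_def]]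
  have "has_bochner_integral lborel (\<lambda>x. x powr p * levy_density d k x)
           (pi powr s / Gamma s * Beta (r / 2 + j) s)"
    by (simp only: mp[unfolded m_def] s_def)
  from has_bochner_integral_divide_zero[OF this, of "levy_variance d k"]
  have "has_bochner_integral lborel (\<lambda>x. x powr p * levy_density d k x / levy_variance d k)
           (pi powr s / Gamma s * Beta (r / 2 + j) s / levy_variance d k)" by simp
  moreover have "pi powr s / Gamma s * Beta (r / 2 + j) s / levy_variance d k = Beta (r / 2 + j) s / Beta (r / 2) s"
  proof -
    have "levy_variance d k = pi powr s / Gamma s * Beta (r / 2) s"
      using Gamma_real_pos[OF s] unfolding levy_variance_def Beta_def
      by (simp add: rs flip: r_def m_def s_def)
    moreover have "pi powr s / Gamma s \<noteq> 0" using Gamma_real_pos[OF s] by simp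
    ultimately show ?thesis using mult_divide_mult_cancel_left by metis
  qed
  moreover have "(\<lambda>x. x powr p * levy_density d k x / levy_variance d k) =
      (\<lambda>x. (x\<^sup>2 * levy_density d k x / levy_variance d k) *\<^sub>R x powr (2 * j / m))"
  proof
    show "x powr p * levy_density d k x / levy_variance d k =
        (x\<^sup>2 * levy_density d k x / levy_variance d k) *\<^sub>R x powr (2 * j / m)" for x
      by (cases "x \<in> {0<..<1}") (simp_all add: levy_density_eq_0 p_def powr_add)
  qed
  ultimately have *: "has_bochner_integral lborel
      (\<lambda>x. (x\<^sup>2 * levy_density d k x / levy_variance d k) *\<^sub>R x powr (2 * j / m))
      (Beta (r / 2 + j) s / Beta (r / 2) s)"
    by metis
  show ?thesis
    unfolding size_biased_def m_def[symmetric] r_def[symmetric]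
    by (intro has_bochner_integral_density[OF _ _ _ *])
       (measurable, measurable, rule AE_I2, rule size_biased_density_nonneg[OF adm])
qed

lemma prob_space_size_biased:
  assumes adm: "admissible d k" shows "prob_space (size_biased d k)"
proof -
  have "Beta (excess d k / 2) ((real d - real k) / 2) > 0"
    using admissibleD(2,3)[OF adm] unfolding Beta_def
    by (intro divide_pos_pos mult_pos_pos Gamma_real_pos add_pos_pos) auto
  then have "has_bochner_integral (size_biased d k) (\<lambda>x. x powr 0) 1"
    using size_biased_moment[OF adm, of 0] admissibleD(3)[OF adm] by simp
  moreover have "AE x in size_biased d k. x powr 0 = (1 :: real)"
    using size_biased_AE by eventually_elim simp
  ultimately have *: "has_bochner_integral (size_biased d k) (\<lambda>x. 1 :: real) 1"
    by (subst (asm) has_bochner_integral_cong_AE[where g = "\<lambda>_. 1"]) auto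
  then have "(\<integral>\<^sup>+x. ennreal 1 \<partial>size_biased d k) = ennreal 1"
    by (subst nn_integral_eq_integral) (auto simp: has_bochner_integral_iff)
  then have "emeasure (size_biased d k) UNIV = 1" by simp
  then show ?thesis by (intro prob_spaceI) (simp only: space_size_biased)
qed

text \<open>The recursion \<open>B(y + 1, s) = y / (y + s) * B(y, s)\<close> makes the moments of orders \<open>1\<close>, \<open>2\<close> and \<open>-1\<close>
  rational: the mean of the Beta variable is \<open>r / m\<close>, which is the centre in the first statement.\<close>

lemma size_biased_variance_and_inverse_mean:
  assumes adm: "admissible d k"
  defines "m \<equiv> real k - 1" and "r \<equiv> excess d k"
  shows "has_bochner_integral (size_biased d k) (\<lambda>x. (x powr (2 / m) - r / m)\<^sup>2)
           (2 * r * (m - r) / (m\<^sup>2 * (m + 2)))"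
    and "r > 2 \<Longrightarrow> has_bochner_integral (size_biased d k) (\<lambda>x. x powr (- 2 / m)) ((m - 2) / (r - 2))"
proof -
  interpret prob_space "size_biased d k" by (rule prob_space_size_biased[OF adm])
  define s where "s = (real d - real k) / 2"
  note A = admissibleD[OF adm]
  have m: "m \<ge> 2" and s: "s > 0" and r: "r \<ge> 1" and rs: "r / 2 + s = m / 2"
    using A by (auto simp: m_def s_def r_def field_simps)
  have nz: "Beta (r / 2) s \<noteq> 0" using s r rs by (auto simp: Beta_def Gamma_eq_zero_iff)
  have pos: "x \<notin> \<int>\<^sub>\<le>\<^sub>0" if "x > 0" for x :: real using that by (auto elim!: nonpos_Ints_cases)
  have step: "Beta (y + 1) s = y / (y + s) * Beta y s" if "y > 0" for y
    using Beta_plus1_left[OF pos[OF that], of s] that s by (simp add: field_simps)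
  have "r / 2 / (r / 2 + s) = r / m" and "(r / 2 + 1) / (r / 2 + 1 + s) = (r + 2) / (m + 2)"
    using rs m r by (auto simp: divide_simps) (auto simp: algebra_simps)
  then have b1: "Beta (r / 2 + 1) s = r / m * Beta (r / 2) s"
    and b2: "Beta (r / 2 + 1 + 1) s = (r + 2) / (m + 2) * Beta (r / 2 + 1) s"
    using step[of "r / 2"] step[of "r / 2 + 1"] r by simp_all
  note moment = size_biased_moment[OF adm, folded r_def m_def s_def]
  have "Beta (r / 2 + 1) s / Beta (r / 2) s = r / m" using b1 nz by simp
  then have 1: "has_bochner_integral (size_biased d k) (\<lambda>x. x powr (2 / m)) (r / m)"
    using moment[of 1] r by simp
  have "Beta (r / 2 + 2) s / Beta (r / 2) s = (r + 2) / (m + 2) * (r / m)"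
    using b1 b2 nz by (simp add: add.assoc)
  then have 2: "has_bochner_integral (size_biased d k) (\<lambda>x. x powr (4 / m)) ((r + 2) / (m + 2) * (r / m))"
    using moment[of 2] r by simp
  have c: "has_bochner_integral (size_biased d k) (\<lambda>x. (r / m)\<^sup>2) ((r / m)\<^sup>2)"
    using prob_space by (simp add: has_bochner_integral_iff)
  have eq: "(x powr (2 / m) - r / m)\<^sup>2 = x powr (4 / m) - 2 * (r / m) * x powr (2 / m) + (r / m)\<^sup>2" for x
    by (simp add: power2_diff algebra_simps power2_eq_square flip: powr_add)
  have val: "(r + 2) / (m + 2) * (r / m) - 2 * (r / m) * (r / m) + (r / m)\<^sup>2 = 2 * r * (m - r) / (m\<^sup>2 * (m + 2))"
  proof -
    have "(r + 2) / (m + 2) - r / m = 2 * (m - r) / (m * (m + 2))"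
      using m by (simp add: divide_simps) (simp add: algebra_simps)
    then have "r / m * ((r + 2) / (m + 2) - r / m) = r / m * (2 * (m - r) / (m * (m + 2)))"
      by (rule arg_cong)
    also have "\<dots> = 2 * r * (m - r) / (m\<^sup>2 * (m + 2))"
      by (simp only: power2_eq_square times_divide_times_eq ac_simps)
    finally have "r / m * ((r + 2) / (m + 2) - r / m) = 2 * r * (m - r) / (m\<^sup>2 * (m + 2))" .
    then show ?thesis by (simp add: algebra_simps power2_eq_square)
  qed
  show "has_bochner_integral (size_biased d k) (\<lambda>x. (x powr (2 / m) - r / m)\<^sup>2)
           (2 * r * (m - r) / (m\<^sup>2 * (m + 2)))"
    unfolding eq val[symmetric]
    by (intro has_bochner_integral_add has_bochner_integral_diff has_bochner_integral_mult_right 1 2 c)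
  assume r2: "r > 2"
  have "(r / 2 - 1) / (r / 2 - 1 + s) = (r - 2) / (m - 2)"
    using rs r2 s by (auto simp: divide_simps) (auto simp: algebra_simps)
  then have "Beta (r / 2) s = (r - 2) / (m - 2) * Beta (r / 2 - 1) s"
    using step[of "r / 2 - 1"] r2 by simp
  then have "Beta (r / 2 - 1) s / Beta (r / 2) s = (m - 2) / (r - 2)"
    using r2 nz by (cases "m = 2") auto
  then show "has_bochner_integral (size_biased d k) (\<lambda>x. x powr (- 2 / m)) ((m - 2) / (r - 2))"
    using moment[of "-1"] r2 by simp
qed

section \<open>Characteristic functions and the Levy kernel\<close>

text \<open>A second-order expansion of the characteristic function at \<open>0\<close> forces a finite second moment:
  \<open>(1 - cos (h x)) / h\<^sup>2\<close> has a bounded integral and tends to \<open>x\<^sup>2 / 2\<close>, so Fatou's lemma applies. Once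
  \<open>x\<^sup>2\<close> is integrable it dominates, which identifies the second moment; the mean comes in the same
  way from \<open>sin (h x) / h\<close>.\<close>

lemma (in real_distribution) second_moment_from_char:
  assumes lim: "((\<lambda>t. (1 - char M t) / (complex_of_real t)\<^sup>2) \<longlongrightarrow> complex_of_real (v / 2)) (at 0)"
  shows "integrable M (\<lambda>x. x\<^sup>2)" "expectation (\<lambda>x. x) = 0" "expectation (\<lambda>x. x\<^sup>2) = v"
proof -
  define h where "h = (\<lambda>n. inverse (real (Suc n)))"
  have h: "h n > 0" for n by (simp add: h_def)
  have h_lim: "filterlim h (at 0) sequentially"
    using LIMSEQ_inverse_real_of_nat h unfolding h_def[symmetric]
    by (simp add: filterlim_at less_imp_neq[symmetric] h_def)
  have hh: "h \<longlonglongrightarrow> 0" using h_lim by (simp add: filterlim_at)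
  have iexp_int: "integrable M (\<lambda>x. iexp (t * x))" for t
    by (intro integrable_const_bound[where B = 1]) auto
  have Re: "Re (char M t) = expectation (\<lambda>x. cos (t * x))" for t
    unfolding char_def using integral_Re[OF iexp_int[of t]]
    by (simp add: cis_conv_exp[symmetric] del: of_real_mult)
  have Im: "Im (char M t) = expectation (\<lambda>x. sin (t * x))" for t
    unfolding char_def using integral_Im[OF iexp_int[of t]]
    by (simp add: cis_conv_exp[symmetric] del: of_real_mult)
  have cos_int: "integrable M (\<lambda>x. cos (t * x))" for t
    by (intro integrable_const_bound[where B = 1]) auto
  define q where "q = (\<lambda>n x. (1 - cos (h n * x)) / (h n)\<^sup>2)"
  have q_int: "integrable M (q n)" for n
    unfolding q_def using cos_int by auto
  have q_pos: "q n x \<ge> 0" for n x by (simp add: q_def)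
  have seq: "(\<lambda>n. (1 - char M (h n)) / (complex_of_real (h n))\<^sup>2) \<longlonglongrightarrow> complex_of_real (v / 2)"
    using filterlim_compose[OF lim h_lim] .
  have "Re ((1 - char M (h n)) / (complex_of_real (h n))\<^sup>2) = expectation (q n)" for n
    using cos_int prob_space unfolding q_def
    by (simp add: Re Re_divide_of_real flip: of_real_power)
  with tendsto_Re[OF seq] have q_lim: "(\<lambda>n. expectation (q n)) \<longlonglongrightarrow> v / 2" by simp
  have q_point: "(\<lambda>n. q n x) \<longlonglongrightarrow> x\<^sup>2 / 2" for x
  proof -
    have "((\<lambda>t. (1 - cos (t * x)) / t\<^sup>2) \<longlongrightarrow> x\<^sup>2 / 2) (at 0)"
      unfolding power2_eq_square by real_asymp
    from filterlim_compose[OF this h_lim] show ?thesis by (simp add: q_def)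
  qed
  have q_le: "q n x \<le> x\<^sup>2 / 2" for n x
  proof -
    have "1 - cos (h n * x) = 2 * (sin (h n * x / 2))\<^sup>2"
      using cos_double_sin[of "h n * x / 2"] by simp
    moreover have "(sin (h n * x / 2))\<^sup>2 \<le> (h n * x / 2)\<^sup>2"
      using abs_sin_x_le_abs_x by (simp add: abs_le_square_iff)
    ultimately have "1 - cos (h n * x) \<le> (h n)\<^sup>2 * (x\<^sup>2 / 2)"
      by (simp add: power_mult_distrib power_divide)
    then show ?thesis using h[of n] by (simp add: q_def divide_le_eq mult.commute)
  qed
  have "(\<integral>\<^sup>+x. ennreal (x\<^sup>2 / 2) \<partial>M) = (\<integral>\<^sup>+x. liminf (\<lambda>n. ennreal (q n x)) \<partial>M)"
    by (intro nn_integral_cong lim_imp_Liminf[symmetric] tendsto_ennrealI q_point) auto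
  also have "\<dots> \<le> liminf (\<lambda>n. \<integral>\<^sup>+x. ennreal (q n x) \<partial>M)"
    using q_int by (intro nn_integral_liminf) auto
  also have "\<dots> = liminf (\<lambda>n. ennreal (expectation (q n)))"
    using q_int q_pos by (simp add: nn_integral_eq_integral)
  also have "\<dots> = ennreal (v / 2)"
    by (intro lim_imp_Liminf tendsto_ennrealI q_lim) auto
  finally have "(\<integral>\<^sup>+x. ennreal (x\<^sup>2 / 2) \<partial>M) < \<infinity>" by (simp add: le_less_trans)
  then have sq2: "integrable M (\<lambda>x. x\<^sup>2 / 2)"
    by (intro integrableI_nonneg) auto
  then have "integrable M (\<lambda>x. 2 * (x\<^sup>2 / 2))" by (intro integrable_mult_right)
  then show sq: "integrable M (\<lambda>x. x\<^sup>2)" by simp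
  have "(\<lambda>n. expectation (q n)) \<longlonglongrightarrow> expectation (\<lambda>x. x\<^sup>2 / 2)"
    using q_pos q_le q_point q_int
    by (intro integral_dominated_convergence[where w = "\<lambda>x. x\<^sup>2 / 2"] sq2) auto
  with q_lim have "expectation (\<lambda>x. x\<^sup>2 / 2) = v / 2" by (rule LIMSEQ_unique[symmetric])
  moreover have "expectation (\<lambda>x. x\<^sup>2 / 2) = expectation (\<lambda>x. x\<^sup>2) / 2"
    by (rule integral_divide_zero)
  ultimately show "expectation (\<lambda>x. x\<^sup>2) = v" by linarith
  have ident: "integrable M (\<lambda>x. x)" by (rule square_integrable_imp_integrable[OF _ sq]) simp
  have "(\<lambda>n. expectation (\<lambda>x. sin (h n * x) / h n)) \<longlonglongrightarrow> expectation (\<lambda>x. x)"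
  proof (intro integral_dominated_convergence[where w = "\<lambda>x. \<bar>x\<bar>"] AE_I2)
    show "(\<lambda>n. sin (h n * x) / h n) \<longlonglongrightarrow> x" for x
    proof -
      have "((\<lambda>t. sin (t * x) / t) \<longlongrightarrow> x) (at 0)" by real_asymp
      from filterlim_compose[OF this h_lim] show ?thesis by simp
    qed
    show "norm (sin (h n * x) / h n) \<le> \<bar>x\<bar>" for n x
      using abs_sin_x_le_abs_x[of "h n * x"] h[of n] by (simp add: abs_mult divide_le_eq mult.commute)
    show "integrable M (\<lambda>x. \<bar>x\<bar>)" using ident by (rule integrable_abs)
  qed simp_all
  moreover have "(\<lambda>n. expectation (\<lambda>x. sin (h n * x) / h n)) \<longlonglongrightarrow> 0"
  proof -
    have "- (h n * Im ((1 - char M (h n)) / (complex_of_real (h n))\<^sup>2)) = expectation (\<lambda>x. sin (h n * x) / h n)" for n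
      using h[of n] by (simp add: Im Im_divide_of_real power2_eq_square flip: of_real_power)
    with tendsto_minus[OF tendsto_mult[OF hh tendsto_Im[OF seq]]] show ?thesis by simp
  qed
  ultimately show "expectation (\<lambda>x. x) = 0" by (rule LIMSEQ_unique)
qed

text \<open>The integrand of the characteristic exponent relative to the size-biased measure. At \<open>x = 0\<close> the
  value is the default \<open>0\<close> and not the limit \<open>- t\<^sup>2 / 2\<close>; the point \<open>0\<close> has measure zero wherever the
  kernel is integrated.\<close>

definition levy_kernel :: "real \<Rightarrow> real \<Rightarrow> complex" where
  "levy_kernel t x = (iexp (t * x) - 1 - \<i> * complex_of_real (t * x)) / (complex_of_real x)\<^sup>2"

lemma levy_kernel_measurable [measurable]: "levy_kernel t \<in> borel_measurable borel"
  unfolding levy_kernel_def by measurable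

lemma norm_levy_kernel:
  "norm (levy_kernel t x) = norm (iexp (t * x) - (\<Sum>j\<le>1. (\<i> * complex_of_real (t * x)) ^ j / fact j)) / x\<^sup>2"
  by (simp add: levy_kernel_def norm_divide norm_power algebra_simps)

lemma norm_levy_kernel_le_square: "norm (levy_kernel t x) \<le> t\<^sup>2 / 2"
proof -
  have "norm (levy_kernel t x) \<le> (t * x)\<^sup>2 / 2 / x\<^sup>2"
    unfolding norm_levy_kernel using iexp_approx1[of "t * x" 1]
    by (intro divide_right_mono) (simp_all add: power2_eq_square abs_mult)
  also have "\<dots> \<le> t\<^sup>2 / 2" by (cases "x = 0") (simp_all add: power_mult_distrib)
  finally show ?thesis .
qed

text \<open>The first-order remainder of the exponential is also at most \<open>2 |t x|\<close>, which makes the kernel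
  vanish at infinity.\<close>

lemma norm_levy_kernel_le_inverse: "norm (levy_kernel t x) \<le> 2 * \<bar>t\<bar> / \<bar>x\<bar>"
proof -
  have "norm (levy_kernel t x) \<le> 2 * \<bar>t * x\<bar> / x\<^sup>2"
    unfolding norm_levy_kernel using iexp_approx2[of "t * x" 1]
    by (intro divide_right_mono) simp_all
  also have "\<dots> = 2 * \<bar>t\<bar> / \<bar>x\<bar>"
    unfolding power2_abs[of x, symmetric] by (simp add: abs_mult power2_eq_square del: abs_mult_self_eq power2_abs)
  finally show ?thesis .
qed

text \<open>The second-order remainder of the exponential controls the distance from the limit at \<open>0\<close>.\<close>

lemma norm_levy_kernel_near_0:
  assumes "x \<noteq> 0"
  shows "norm (levy_kernel t x + complex_of_real (t\<^sup>2 / 2)) \<le> \<bar>t\<bar> ^ 3 * \<bar>x\<bar> / 6"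
proof -
  have "levy_kernel t x + complex_of_real (t\<^sup>2 / 2) =
      (iexp (t * x) - (\<Sum>j\<le>2. (\<i> * complex_of_real (t * x)) ^ j / fact j)) / (complex_of_real x)\<^sup>2"
    using assms by (simp add: levy_kernel_def numeral_2_eq_2 power2_eq_square field_simps)
  then have "norm (levy_kernel t x + complex_of_real (t\<^sup>2 / 2)) =
      norm (iexp (t * x) - (\<Sum>j\<le>2. (\<i> * complex_of_real (t * x)) ^ j / fact j)) / x\<^sup>2"
    by (simp only: norm_divide norm_power norm_of_real power2_abs)
  also have "\<dots> \<le> \<bar>t * x\<bar> ^ 3 / 6 / x\<^sup>2"
    using iexp_approx1[of "t * x" 2] by (intro divide_right_mono) (simp_all add: fact_numeral)
  also have "\<bar>t * x\<bar> ^ 3 = \<bar>t\<bar> ^ 3 * \<bar>x\<bar> * x\<^sup>2"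
    by (subst power2_abs[of x, symmetric])
       (simp only: abs_mult power_mult_distrib power3_eq_cube power2_eq_square ac_simps)
  finally show ?thesis using assms by simp
qed

lemma integral_levy_measure:
  assumes adm: "admissible d k"
  shows "(\<integral>x. (iexp (t * x) - 1 - \<i> * complex_of_real (t * x)) \<partial>levy_measure d k) =
     levy_variance d k * (\<integral>x. levy_kernel t x \<partial>size_biased d k)"
proof -
  have "(\<integral>x. (iexp (t * x) - 1 - \<i> * complex_of_real (t * x)) \<partial>levy_measure d k) =
     (\<integral>x. levy_density d k x *\<^sub>R (iexp (t * x) - 1 - \<i> * complex_of_real (t * x)) \<partial>lborel)"
    unfolding levy_measure_def
    by (intro integral_density) (auto intro!: levy_density_nonneg adm)
  also have "\<dots> = (\<integral>x. levy_variance d k *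
      ((x\<^sup>2 * levy_density d k x / levy_variance d k) *\<^sub>R levy_kernel t x) \<partial>lborel)"
  proof (intro Bochner_Integration.integral_cong refl)
    fix x
    show "levy_density d k x *\<^sub>R (iexp (t * x) - 1 - \<i> * complex_of_real (t * x)) =
       levy_variance d k * ((x\<^sup>2 * levy_density d k x / levy_variance d k) *\<^sub>R levy_kernel t x)"
    proof (cases "x = 0")
      case False
      then show ?thesis
        using levy_variance_pos[OF adm] by (simp add: levy_kernel_def scaleR_conv_of_real)
    qed (simp add: levy_density_eq_0)
  qed
  also have "\<dots> = levy_variance d k *
      (\<integral>x. (x\<^sup>2 * levy_density d k x / levy_variance d k) *\<^sub>R levy_kernel t x \<partial>lborel)"
    by (rule integral_mult_right_zero)
  also have "\<dots> = levy_variance d k * (\<integral>x. levy_kernel t x \<partial>size_biased d k)"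
    by (simp only: integral_size_biased[OF adm levy_kernel_measurable])
  finally show ?thesis .
qed

lemma char_Z:
  assumes "is_Z M Z d k" and adm: "admissible d k"
  shows "char (distr M borel Z) t = exp (levy_variance d k * (\<integral>x. levy_kernel t x \<partial>size_biased d k))"
  using assms integral_levy_measure[OF adm] by (simp add: is_Z_def)

lemma levy_kernel_integrable: 
  assumes "prob_space \<mu>" "sets \<mu> = sets borel"
  shows "integrable \<mu> (\<lambda>x. levy_kernel t (x / s))"
proof -
  interpret prob_space \<mu> by fact
  note assms(2)[measurable_cong]
  show ?thesis
    by (intro integrable_const_bound[where B = "t\<^sup>2 / 2"] AE_I2 norm_levy_kernel_le_square) measurable
qed

text \<open>Up to \<open>h * s n\<close> the kernel is within \<open>O(h)\<close> of \<open>- t\<^sup>2 / 2\<close>; beyond, its boundedness and the vanishing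
  tail suffice.\<close>

lemma levy_kernel_gaussian_limit:
  fixes \<mu> :: "nat \<Rightarrow> real measure"
  assumes \<mu>: "\<And>n. prob_space (\<mu> n)" and [measurable_cong]: "\<And>n. sets (\<mu> n) = sets borel"
    and pos: "\<And>n. AE x in \<mu> n. x > 0" and s: "\<And>n. s n > 0"
    and lim: "\<And>h. h > 0 \<Longrightarrow> (\<lambda>n. measure (\<mu> n) {x. h * s n < x}) \<longlonglongrightarrow> 0"
  shows "(\<lambda>n. \<integral>x. levy_kernel t (x / s n) \<partial>\<mu> n) \<longlonglongrightarrow> - complex_of_real (t\<^sup>2 / 2)"
proof (rule LIMSEQ_I)
  fix e :: real assume e: "e > 0"
  define h where "h = 3 * e / (\<bar>t\<bar> ^ 3 + 1)"
  have h: "h > 0" using e by (simp add: h_def add_nonneg_pos)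
  have "(\<bar>t\<bar> ^ 3 + 1) * h = 3 * e"
    by (simp add: h_def add_nonneg_pos[THEN less_imp_neq, symmetric])
  then have hs: "\<bar>t\<bar> ^ 3 * h / 6 \<le> e / 2" using h by (simp add: algebra_simps)
  have bound: "norm ((\<integral>x. levy_kernel t (x / s n) \<partial>\<mu> n) - - complex_of_real (t\<^sup>2 / 2)) \<le>
      \<bar>t\<bar> ^ 3 * h / 6 + t\<^sup>2 * measure (\<mu> n) {x. h * s n < x}" for n
  proof -
    interpret prob_space "\<mu> n" by (rule \<mu>)
    note int = levy_kernel_integrable[OF \<mu> assms(2), of n t "s n"]
    have sp: "space (\<mu> n) = UNIV" using sets_eq_imp_space_eq[OF assms(2)[of n]] by simp
    have "norm ((\<integral>x. levy_kernel t (x / s n) \<partial>\<mu> n) - - complex_of_real (t\<^sup>2 / 2)) =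
        norm (\<integral>x. levy_kernel t (x / s n) + complex_of_real (t\<^sup>2 / 2) \<partial>\<mu> n)"
      using int by (simp add: prob_space)
    also have "\<dots> \<le> (\<integral>x. norm (levy_kernel t (x / s n) + complex_of_real (t\<^sup>2 / 2)) \<partial>\<mu> n)"
      by (rule integral_norm_bound)
    also have "\<dots> \<le> (\<integral>x. \<bar>t\<bar> ^ 3 * h / 6 + t\<^sup>2 * indicator {x. h * s n < x} x \<partial>\<mu> n)"
    proof (rule integral_mono_AE)
      show "AE x in \<mu> n. norm (levy_kernel t (x / s n) + complex_of_real (t\<^sup>2 / 2)) \<le>
          \<bar>t\<bar> ^ 3 * h / 6 + t\<^sup>2 * indicator {x. h * s n < x} x"
        using pos
      proof eventually_elim
        case (elim x)
        show ?case
        proof (cases "h * s n < x")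
          case True
          have "norm (levy_kernel t (x / s n) + complex_of_real (t\<^sup>2 / 2)) \<le> t\<^sup>2 / 2 + t\<^sup>2 / 2"
            by (rule norm_triangle_le) (use norm_levy_kernel_le_square[of t "x / s n"] in \<open>simp add: norm_divide norm_power\<close>)
          then show ?thesis using True h by (simp add: add_increasing)
        next
          case False
          have "norm (levy_kernel t (x / s n) + complex_of_real (t\<^sup>2 / 2)) \<le> \<bar>t\<bar> ^ 3 * \<bar>x / s n\<bar> / 6"
            using norm_levy_kernel_near_0[of "x / s n" t] elim s[of n] by simp
          also have "\<dots> \<le> \<bar>t\<bar> ^ 3 * h / 6"
            using False elim s[of n] by (intro divide_right_mono mult_left_mono) (auto simp: field_simps)
          finally show ?thesis using False by simp
        qed
      qed
    qed (use int in \<open>auto simp: emeasure_eq_measure\<close>)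
    also have "\<dots> = \<bar>t\<bar> ^ 3 * h / 6 + t\<^sup>2 * measure (\<mu> n) {x. h * s n < x}"
      using prob_space by (simp add: emeasure_eq_measure sp)
    finally show ?thesis .
  qed
  have "(\<lambda>n. t\<^sup>2 * measure (\<mu> n) {x. h * s n < x}) \<longlonglongrightarrow> 0"
    using tendsto_mult_left[OF lim[OF h], of "t\<^sup>2"] by simp
  then have "eventually (\<lambda>n. t\<^sup>2 * measure (\<mu> n) {x. h * s n < x} < e / 2) sequentially"
    by (rule order_tendstoD(2)) (use e in simp)
  then obtain N where N: "\<And>n. n \<ge> N \<Longrightarrow> t\<^sup>2 * measure (\<mu> n) {x. h * s n < x} < e / 2"
    by (auto simp: eventually_sequentially)
  show "\<exists>N. \<forall>n\<ge>N. norm ((\<integral>x. levy_kernel t (x / s n) \<partial>\<mu> n) - - complex_of_real (t\<^sup>2 / 2)) < e"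
  proof (intro exI allI impI)
    fix n assume "n \<ge> N"
    from N[OF this] bound[of n] hs
    show "norm ((\<integral>x. levy_kernel t (x / s n) \<partial>\<mu> n) - - complex_of_real (t\<^sup>2 / 2)) < e" by linarith
  qed
qed

text \<open>Beyond \<open>B * s n\<close> the kernel is \<open>O(1 / B)\<close>; below, it is bounded on a set of vanishing measure.\<close>

lemma levy_kernel_degenerate_limit:
  fixes \<mu> :: "nat \<Rightarrow> real measure"
  assumes \<mu>: "\<And>n. prob_space (\<mu> n)" and [measurable_cong]: "\<And>n. sets (\<mu> n) = sets borel"
    and pos: "\<And>n. AE x in \<mu> n. x > 0" and s: "\<And>n. s n > 0"
    and lim: "\<And>B. B > 0 \<Longrightarrow> (\<lambda>n. measure (\<mu> n) {x. x \<le> B * s n}) \<longlonglongrightarrow> 0"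
  shows "(\<lambda>n. \<integral>x. levy_kernel t (x / s n) \<partial>\<mu> n) \<longlonglongrightarrow> 0"
proof (rule LIMSEQ_I)
  fix e :: real assume e: "e > 0"
  define B where "B = 4 * (\<bar>t\<bar> + 1) / e"
  have B: "B > 0" using e by (simp add: B_def add_nonneg_pos)
  have Be: "2 * \<bar>t\<bar> / B \<le> e / 2"
    using e by (simp add: B_def field_simps add_nonneg_pos)
  have bound: "norm (\<integral>x. levy_kernel t (x / s n) \<partial>\<mu> n) \<le>
      t\<^sup>2 / 2 * measure (\<mu> n) {x. x \<le> B * s n} + 2 * \<bar>t\<bar> / B" for n
  proof -
    interpret prob_space "\<mu> n" by (rule \<mu>)
    note int = levy_kernel_integrable[OF \<mu> assms(2), of n t "s n"]
    have sp: "space (\<mu> n) = UNIV" using sets_eq_imp_space_eq[OF assms(2)[of n]] by simp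
    have "norm (\<integral>x. levy_kernel t (x / s n) \<partial>\<mu> n) \<le> (\<integral>x. norm (levy_kernel t (x / s n)) \<partial>\<mu> n)"
      by (rule integral_norm_bound)
    also have "\<dots> \<le> (\<integral>x. t\<^sup>2 / 2 * indicator {x. x \<le> B * s n} x + 2 * \<bar>t\<bar> / B \<partial>\<mu> n)"
    proof (rule integral_mono_AE)
      show "AE x in \<mu> n. norm (levy_kernel t (x / s n)) \<le>
          t\<^sup>2 / 2 * indicator {x. x \<le> B * s n} x + 2 * \<bar>t\<bar> / B"
        using pos
      proof eventually_elim
        case (elim x)
        show ?case
        proof (cases "x \<le> B * s n")
          case True
          then show ?thesis using norm_levy_kernel_le_square[of t "x / s n"] B by (simp add: add_increasing2)
        next
          case False
          then have "B \<le> \<bar>x / s n\<bar>" using s[of n] by (simp add: field_simps)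
          then have "2 * \<bar>t\<bar> / \<bar>x / s n\<bar> \<le> 2 * \<bar>t\<bar> / B"
            using B by (intro frac_le) auto
          with norm_levy_kernel_le_inverse[of t "x / s n"] show ?thesis using False by simp
        qed
      qed
    qed (use int in \<open>auto simp: emeasure_eq_measure\<close>)
    also have "\<dots> = t\<^sup>2 / 2 * measure (\<mu> n) {x. x \<le> B * s n} + 2 * \<bar>t\<bar> / B"
      using prob_space by (simp add: emeasure_eq_measure sp)
    finally show ?thesis .
  qed
  have "(\<lambda>n. t\<^sup>2 / 2 * measure (\<mu> n) {x. x \<le> B * s n}) \<longlonglongrightarrow> 0"
    using tendsto_mult_left[OF lim[OF B], of "t\<^sup>2 / 2"] by simp
  then have "eventually (\<lambda>n. t\<^sup>2 / 2 * measure (\<mu> n) {x. x \<le> B * s n} < e / 2) sequentially"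
    by (rule order_tendstoD(2)) (use e in simp)
  then obtain N where N: "\<And>n. n \<ge> N \<Longrightarrow> t\<^sup>2 / 2 * measure (\<mu> n) {x. x \<le> B * s n} < e / 2"
    by (auto simp: eventually_sequentially)
  show "\<exists>N. \<forall>n\<ge>N. norm ((\<integral>x. levy_kernel t (x / s n) \<partial>\<mu> n) - 0) < e"
  proof (intro exI allI impI)
    fix n assume "n \<ge> N"
    from N[OF this] bound[of n] Be
    show "norm ((\<integral>x. levy_kernel t (x / s n) \<partial>\<mu> n) - 0) < e" by simp
  qed
qed

text \<open>On the unit interval the kernel is \<open>- t\<^sup>2 / 2 + O(t ^ 3)\<close> uniformly, so the exponent is
  \<open>- v t\<^sup>2 / 2 + O(t ^ 3)\<close> and the characteristic function has the expansion required by
  \<open>second_moment_from_char\<close>.\<close>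

lemma variance_Z:
  assumes Z: "is_Z M Z d k" and adm: "admissible d k"
  shows "prob_space.variance M Z = levy_variance d k"
proof -
  interpret prob_space M using Z by (simp add: is_Z_def)
  have [measurable]: "Z \<in> borel_measurable M" using Z by (simp add: is_Z_def)
  interpret N: real_distribution "distr M borel Z" by (rule real_distribution_distr) simp
  interpret S: prob_space "size_biased d k" by (rule prob_space_size_biased[OF adm])
  define v where "v = levy_variance d k"
  have v: "v > 0" using levy_variance_pos[OF adm] by (simp add: v_def)
  define z where "z = (\<lambda>t. complex_of_real v * (\<integral>x. levy_kernel t x \<partial>size_biased d k))"
  have char: "char (distr M borel Z) t = exp (z t)" for t
    using char_Z[OF Z adm] by (simp add: z_def v_def)
  have kint: "integrable (size_biased d k) (levy_kernel t)" for t
    using levy_kernel_integrable[OF S.prob_space_axioms sets_size_biased, of t 1] by simp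
  have near: "norm (z t / (complex_of_real t)\<^sup>2 - - complex_of_real (v / 2)) \<le> v * \<bar>t\<bar> / 6" if t: "t \<noteq> 0" for t
  proof -
    have "norm ((\<integral>x. levy_kernel t x \<partial>size_biased d k) + complex_of_real (t\<^sup>2 / 2)) =
        norm (\<integral>x. levy_kernel t x + complex_of_real (t\<^sup>2 / 2) \<partial>size_biased d k)"
      using kint S.prob_space by simp
    also have "\<dots> \<le> (\<integral>x. norm (levy_kernel t x + complex_of_real (t\<^sup>2 / 2)) \<partial>size_biased d k)"
      by (rule integral_norm_bound)
    also have "\<dots> \<le> (\<integral>x. \<bar>t\<bar> ^ 3 / 6 \<partial>size_biased d k)"
    proof (rule integral_mono_AE)
      show "AE x in size_biased d k. norm (levy_kernel t x + complex_of_real (t\<^sup>2 / 2)) \<le> \<bar>t\<bar> ^ 3 / 6"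
        using size_biased_AE
      proof eventually_elim
        case (elim x)
        then have "\<bar>t\<bar> ^ 3 * \<bar>x\<bar> \<le> \<bar>t\<bar> ^ 3 * 1" by (intro mult_left_mono) auto
        moreover have "x \<noteq> 0" using elim by auto
        note norm_levy_kernel_near_0[OF this, of t]
        ultimately show ?case by linarith
      qed
      show "integrable (size_biased d k) (\<lambda>x. norm (levy_kernel t x + complex_of_real (t\<^sup>2 / 2)))"
        by (intro integrable_norm Bochner_Integration.integrable_add kint S.integrable_const)
      show "integrable (size_biased d k) (\<lambda>x. \<bar>t\<bar> ^ 3 / 6)" by (rule S.integrable_const)
    qed
    finally have le: "norm ((\<integral>x. levy_kernel t x \<partial>size_biased d k) + complex_of_real (t\<^sup>2 / 2)) \<le> \<bar>t\<bar> ^ 3 / 6"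
      using S.prob_space by simp
    have "z t / (complex_of_real t)\<^sup>2 - - complex_of_real (v / 2) =
        complex_of_real (v / t\<^sup>2) * ((\<integral>x. levy_kernel t x \<partial>size_biased d k) + complex_of_real (t\<^sup>2 / 2))"
      using t by (simp add: z_def field_simps)
    then have "norm (z t / (complex_of_real t)\<^sup>2 - - complex_of_real (v / 2)) =
        v / t\<^sup>2 * norm ((\<integral>x. levy_kernel t x \<partial>size_biased d k) + complex_of_real (t\<^sup>2 / 2))"
      using v by (simp add: norm_mult norm_divide norm_power)
    also have "\<dots> \<le> v / t\<^sup>2 * (\<bar>t\<bar> ^ 3 / 6)" using v le by (intro mult_left_mono) auto
    also have "\<dots> = v * \<bar>t\<bar> / 6"
      using t by (simp add: power2_eq_square power3_eq_cube abs_if)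
    finally show ?thesis .
  qed
  have zt: "((\<lambda>t. z t / (complex_of_real t)\<^sup>2) \<longlongrightarrow> - complex_of_real (v / 2)) (at 0)"
  proof (rule LIM_zero_cancel[OF Lim_null_comparison])
    show "\<forall>\<^sub>F t in at 0. norm (z t / (complex_of_real t)\<^sup>2 - - complex_of_real (v / 2)) \<le> v * \<bar>t\<bar> / 6"
      using near by (auto simp: eventually_at_filter)
    show "((\<lambda>t. v * \<bar>t\<bar> / 6) \<longlongrightarrow> 0) (at 0)" by real_asymp
  qed
  have "((\<lambda>t. z t / (complex_of_real t)\<^sup>2 * (complex_of_real t)\<^sup>2) \<longlongrightarrow> - complex_of_real (v / 2) * (complex_of_real 0)\<^sup>2) (at 0)"
    by (intro tendsto_mult zt tendsto_intros)
  then have "((\<lambda>t. z t / (complex_of_real t)\<^sup>2 * (complex_of_real t)\<^sup>2) \<longlongrightarrow> 0) (at 0)"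
    by simp
  then have z0: "(z \<longlongrightarrow> 0) (at 0)"
    by (rule Lim_transform_eventually) (auto simp: eventually_at_filter)
  \<comment> \<open>\<open>z t \<noteq> 0\<close> near \<open>0\<close> allows the factor \<open>(exp (z t) - 1) / z t\<close> to be split off below.\<close>
  have "\<forall>\<^sub>F t in at 0. z t / (complex_of_real t)\<^sup>2 \<noteq> 0"
    using zt v by (intro tendsto_imp_eventually_ne) auto
  then have z_ne: "\<forall>\<^sub>F t in at 0. z t \<noteq> 0" by eventually_elim auto
  have "((\<lambda>t. (exp (z t) - 1) / z t) \<longlongrightarrow> 1) (at 0)"
    using z0 z_ne by (intro filterlim_compose[OF lim_exp_minus_1]) (simp add: filterlim_at)
  from tendsto_minus[OF tendsto_mult[OF this zt]]
  have "((\<lambda>t. - ((exp (z t) - 1) / z t * (z t / (complex_of_real t)\<^sup>2))) \<longlongrightarrow> complex_of_real (v / 2)) (at 0)"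
    by simp
  then have "((\<lambda>t. (1 - char (distr M borel Z) t) / (complex_of_real t)\<^sup>2) \<longlongrightarrow> complex_of_real (v / 2)) (at 0)"
    by (rule Lim_transform_eventually)
       (use z_ne in eventually_elim, simp add: char divide_simps)
  note N = N.second_moment_from_char[OF this]
  have "expectation Z = 0" "expectation (\<lambda>x. (Z x)\<^sup>2) = v"
    using N(2,3) by (simp_all add: integral_distr)
  then show ?thesis by (simp add: v_def)
qed

text \<open>Dividing \<open>Z\<close> by \<open>sqrt v\<close> replaces \<open>t\<close> by \<open>t / sqrt v\<close>, and
  \<open>v * levy_kernel (t / sqrt v) x = levy_kernel t (x / sqrt v)\<close> absorbs the total mass \<open>v\<close>;
  Levy's continuity theorem does the rest.\<close>

lemma converges_in_distribution_from_exponent: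
  assumes Z: "\<And>n. is_Z (M n) (Z n) (d n) (k n)" and adm: "\<And>n. admissible (d n) (k n)"
    and L: "real_distribution L" "\<And>t. char L t = exp (z t)"
    and lim: "\<And>t. (\<lambda>n. \<integral>x. levy_kernel t (x / sqrt (levy_variance (d n) (k n))) \<partial>size_biased (d n) (k n)) \<longlonglongrightarrow> z t"
  shows "converges_in_distribution M (\<lambda>n. variance_normalized (M n) (Z n)) L"
  unfolding converges_in_distribution_def
proof (rule levy_continuity)
  have [measurable]: "Z n \<in> borel_measurable (M n)" for n using Z by (simp add: is_Z_def)
  have [measurable]: "variance_normalized (M n) (Z n) \<in> borel_measurable (M n)" for n
    unfolding variance_normalized_def by measurable
  show "real_distribution (distr (M n) borel (variance_normalized (M n) (Z n)))" for n
  proof -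
    interpret prob_space "M n" using Z[of n] by (simp add: is_Z_def)
    show ?thesis by (rule real_distribution_distr) simp
  qed
  show "real_distribution L" by fact
  fix t
  have "char (distr (M n) borel (variance_normalized (M n) (Z n))) t =
    exp (\<integral>x. levy_kernel t (x / sqrt (levy_variance (d n) (k n))) \<partial>size_biased (d n) (k n))" for n
  proof -
    define v where "v = levy_variance (d n) (k n)"
    have v: "v > 0" using levy_variance_pos[OF adm] by (simp add: v_def)
    have "char (distr (M n) borel (variance_normalized (M n) (Z n))) t = char (distr (M n) borel (Z n)) (t / sqrt v)"
      unfolding char_def variance_normalized_def variance_Z[OF Z adm] v_def[symmetric]
      by (simp add: integral_distr)
    also have "\<dots> = exp (v * (\<integral>x. levy_kernel (t / sqrt v) x \<partial>size_biased (d n) (k n)))"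
      using char_Z[OF Z adm] by (simp add: v_def)
    also have "v * (\<integral>x. levy_kernel (t / sqrt v) x \<partial>size_biased (d n) (k n)) =
        (\<integral>x. v * levy_kernel (t / sqrt v) x \<partial>size_biased (d n) (k n))" by simp
    also have "(\<lambda>x. complex_of_real v * levy_kernel (t / sqrt v) x) = (\<lambda>x. levy_kernel t (x / sqrt v))"
    proof
      show "complex_of_real v * levy_kernel (t / sqrt v) x = levy_kernel t (x / sqrt v)" for x
        using v by (simp add: levy_kernel_def power_divide flip: of_real_power)
    qed
    finally show ?thesis by (simp add: v_def)
  qed
  then show "(\<lambda>n. char (distr (M n) borel (variance_normalized (M n) (Z n))) t) \<longlonglongrightarrow> char L t"
    using tendsto_exp[OF lim[of t]] by (simp add: L)
qed

section \<open>The Gamma function and the size of the variance\<close>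

text \<open>A non-asymptotic Stirling estimate with logarithmic error. Passing from \<open>x\<close> to \<open>x + 1\<close>, the
  difference \<open>ln (Gamma x) - (x ln x - x)\<close> decreases because \<open>1 \<le> (x + 1) ln ((x + 1) / x)\<close>, and it
  increases after adding \<open>ln x\<close> because \<open>x ln ((x + 1) / x) \<le> 1\<close>. Thus the bounds propagate in unit steps
  from \<open>1 / 2\<close> and \<open>1\<close>.\<close>

lemma Gamma_bounds_half_integer:
  assumes "n > 0"
  defines "x \<equiv> real n / 2"
  shows "x * ln x - x - ln x \<le> ln (Gamma x)" "ln (Gamma x) \<le> x * ln x - x + 2"
proof -
  define P where "P = (\<lambda>x :: real. x * ln x - x - ln x \<le> ln (Gamma x) \<and> ln (Gamma x) \<le> x * ln x - x + 2)"
  have half: "P (1 / 2)"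
  proof -
    have "ln (Gamma (1 / 2)) = ln pi / 2"
      by (simp add: Gamma_one_half_real ln_sqrt)
    moreover have "ln (2 :: real) \<le> ln pi" using pi_ge_two by simp
    moreover have "ln (2 :: real) + ln pi \<le> 3 * ln 2"
    proof -
      have "ln (2 * pi) \<le> ln (2 ^ 3)" using pi_less_4 by (subst ln_le_cancel_iff) auto
      then show ?thesis using ln_realpow[of 2 3] by (simp add: ln_mult)
    qed
    moreover have "ln (2 :: real) < 1" by (rule ln2_le_25_over_36[THEN le_less_trans]) simp
    moreover have "ln (1 / 2 :: real) = - ln 2" by (simp add: ln_div)
    ultimately show ?thesis unfolding P_def by - (intro conjI; linarith)
  qed
  have one: "P 1" by (simp add: P_def)
  have step: "P (x + 1)" if "P x" "x > 0" for x
  proof -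
    have "ln (x / (x + 1)) \<le> x / (x + 1) - 1" using that by (intro ln_le_minus_one) auto
    then have "1 / (x + 1) \<le> ln (x + 1) - ln x" using that by (simp add: ln_div field_simps)
    then have 1: "1 \<le> (x + 1) * (ln (x + 1) - ln x)" using that by (simp add: field_simps)
    have "ln ((x + 1) / x) \<le> (x + 1) / x - 1" using that by (intro ln_le_minus_one) auto
    then have "ln (x + 1) - ln x \<le> 1 / x" using that by (simp add: ln_div field_simps)
    then have 2: "x * (ln (x + 1) - ln x) \<le> 1" using that by (simp add: field_simps)
    have "Gamma (x + 1) = x * Gamma x" using that by (intro Gamma_plus1) (auto elim!: nonpos_Ints_cases)
    then have 3: "ln (Gamma (x + 1)) = ln x + ln (Gamma x)" using that Gamma_real_pos[of x] by (simp add: ln_mult del: Gamma_real_pos)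
    show ?thesis using that(1) 1 2 unfolding P_def 3 by (auto simp: algebra_simps)
  qed
  have "P (real n / 2)" if "n > 0" for n :: nat
    using that
  proof (induction n rule: less_induct)
    case (less n)
    show ?case
    proof (cases "n \<le> 2")
      case True
      with less.prems have "n = 1 \<or> n = 2" by auto
      with half one show ?thesis by auto
    next
      case False
      then have "P (real (n - 2) / 2 + 1)" by (intro step less.IH) auto
      with False show ?thesis by (simp add: of_nat_diff add_divide_distrib diff_divide_distrib)
    qed
  qed
  from this[OF assms(1)] show "x * ln x - x - ln x \<le> ln (Gamma x)" "ln (Gamma x) \<le> x * ln x - x + 2"
    by (auto simp: P_def x_def)
qed

text \<open>Convexity of \<open>ln Gamma\<close>: the slope between \<open>y\<close> and \<open>x\<close> is at least the slope between \<open>y - 1\<close> and \<open>y\<close>,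
  which is \<open>ln (y - 1)\<close>.\<close>

lemma ln_Gamma_diff_ge:
  assumes y: "1 < y" and xy: "y \<le> (x :: real)"
  shows "(x - y) * ln (y - 1) \<le> ln (Gamma x) - ln (Gamma y)"
proof -
  \<comment> \<open>\<open>y\<close> is the convex combination of \<open>y - 1\<close> and \<open>x\<close> with weight \<open>1 / D\<close> on \<open>x\<close>.\<close>
  define D where "D = x - y + 1"
  have D: "D \<ge> 1" using xy by (simp add: D_def)
  have yeq: "(1 - 1 / D) *\<^sub>R (y - 1) + (1 / D) *\<^sub>R x = y"
  proof -
    have "D * ((1 - 1 / D) * (y - 1) + (1 / D) * x) = (D - 1) * (y - 1) + x"
    proof -
      have "D * (1 - 1 / D) = D - 1" "D * (1 / D) = 1" using D by (simp_all add: right_diff_distrib)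
      then show ?thesis by (simp only: distrib_left mult.assoc[symmetric])
    qed
    also have "\<dots> = D * y" by (simp add: D_def algebra_simps)
    finally have "D * ((1 - 1 / D) * (y - 1) + (1 / D) * x) = D * y" .
    then show ?thesis
      using D by (metis mult_left_cancel not_one_le_zero real_scaleR_def)
  qed
  have "(ln \<circ> Gamma) ((1 - 1 / D) *\<^sub>R (y - 1) + (1 / D) *\<^sub>R x)
      \<le> (1 - 1 / D) * (ln \<circ> Gamma) (y - 1) + (1 / D) * (ln \<circ> Gamma) x"
    using y xy D by (intro convex_onD[OF log_convex_Gamma_real]) auto
  then have "ln (Gamma y) \<le> (1 - 1 / D) * ln (Gamma (y - 1)) + (1 / D) * ln (Gamma x)"
    unfolding yeq by simp
  then have "D * ln (Gamma y) \<le> D * ((1 - 1 / D) * ln (Gamma (y - 1)) + (1 / D) * ln (Gamma x))"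
    using D by (intro mult_left_mono) auto
  also have "\<dots> = (D - 1) * ln (Gamma (y - 1)) + ln (Gamma x)"
    using D by (simp add: algebra_simps)
  also have "ln (Gamma (y - 1)) = ln (Gamma y) - ln (y - 1)"
  proof -
    have "y - 1 \<notin> \<int>\<^sub>\<le>\<^sub>0" using y by (auto elim!: nonpos_Ints_cases)
    then have "Gamma y = (y - 1) * Gamma (y - 1)"
      using Gamma_plus1[of "y - 1"] by simp
    then show ?thesis using y Gamma_real_pos[of "y - 1"] by (simp add: ln_mult del: Gamma_real_pos)
  qed
  finally show ?thesis by (simp add: D_def algebra_simps)
qed

lemma ln_levy_variance:
  assumes adm: "admissible d k"
  shows "ln (levy_variance d k) = (real d - real k) / 2 * ln pi + ln (Gamma (excess d k / 2))
     - ln (Gamma ((real k - 1) / 2))"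
proof -
  have "Gamma (excess d k / 2) > 0" "Gamma ((real k - 1) / 2) > 0"
    using admissibleD[OF adm] by auto
  then show ?thesis by (simp add: levy_variance_def ln_mult ln_div ln_powr)
qed

text \<open>Unlike Stirling's estimate, this has no additive error, so it is still useful when \<open>d - k\<close> is
  bounded.\<close>

lemma ln_levy_variance_le:
  assumes adm: "admissible d k" and r: "excess d k > 2"
  shows "ln (levy_variance d k) \<le> - (real d - real k) / 2 * ln ((excess d k - 2) / (2 * pi))"
proof -
  note A = admissibleD[OF adm]
  have "((real k - 1) / 2 - excess d k / 2) * ln (excess d k / 2 - 1)
      \<le> ln (Gamma ((real k - 1) / 2)) - ln (Gamma (excess d k / 2))"
    using r A by (intro ln_Gamma_diff_ge) auto
  moreover have "(real k - 1) / 2 - excess d k / 2 = (real d - real k) / 2" using A(4) by (simp add: field_simps)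
  moreover have "ln ((excess d k - 2) / (2 * pi)) = ln (excess d k / 2 - 1) - ln pi"
  proof -
    have "(excess d k - 2) / (2 * pi) = (excess d k / 2 - 1) / pi" by (simp add: field_simps)
    then show ?thesis using r by (simp add: ln_div)
  qed
  ultimately show ?thesis
    unfolding ln_levy_variance[OF adm] by (simp only: right_diff_distrib)
qed

text \<open>The quantity whose position relative to \<open>e pi\<close> decides the limit when \<open>k / d\<close> tends to \<open>1 / 2\<close>.\<close>

definition critical_ratio :: "nat \<Rightarrow> nat \<Rightarrow> real" where
  "critical_ratio d k = excess d k powr (real d / real k) / real d"

text \<open>The logarithm of \<open>(c v) powr (1 / (k - 1))\<close> divided by the mean \<open>excess d k / (k - 1)\<close> of the Beta
  variable.\<close>

definition log_threshold :: "nat \<Rightarrow> nat \<Rightarrow> real \<Rightarrow> real" where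
  "log_threshold d k c =
     ln (real k - 1) - ln (excess d k) + (ln c + ln (levy_variance d k)) / (real k - 1)"

lemma ln_critical_ratio:
  assumes "admissible d k"
  shows "critical_ratio d k > 0"
    "ln (critical_ratio d k) = real d / real k * ln (excess d k) - ln (real d)"
  using admissibleD[OF assms] by (auto simp: critical_ratio_def ln_div ln_powr)

text \<open>After inserting Stirling's estimate, the terms linear in \<open>r / m\<close> and the logarithmic errors divided
  by \<open>m\<close> go into the bound. The coefficient of \<open>ln r\<close> is \<open>r / m - 2\<close> in \<open>2 * log_threshold d k c\<close> and
  \<open>- d / k = (r + 1) / (m + 1) - 2\<close> in \<open>- ln (critical_ratio d k)\<close>; these differ by less than \<open>1 / m\<close>,
  so multiplied by \<open>ln r \<le> ln m\<close> the difference is still negligible. The exponent \<open>d / k\<close> in the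
  critical ratio arises in this way.\<close>

lemma log_threshold_approx:
  assumes adm: "admissible d k"
  defines "m \<equiv> real k - 1" and "r \<equiv> excess d k"
  shows "\<bar>log_threshold d k c - (ln (exp 1 * pi) - ln (critical_ratio d k)) / 2\<bar> \<le>
     \<bar>ln (2 * m / d)\<bar> / 2 + (\<bar>ln c\<bar> + 4 + 3 * ln m) / m + (1 + ln 2 + ln pi) / 2 * (r / m)"
proof -
  note A = admissibleD[OF adm, folded r_def m_def]
  have m: "m \<ge> 2" and r: "r \<ge> 1" and rm: "r \<le> m" and d: "real d > 0"
    using A by (auto simp: m_def)
  have dm: "real d = 2 * m + 1 - r" by (simp add: m_def r_def excess_def)
  have km: "real k = m + 1" by (simp add: m_def)
  have lr: "ln r \<ge> 0" "ln r \<le> ln m" using r rm by auto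
  \<comment> \<open>The Stirling errors of the two Gamma factors, whose arguments are half-integers.\<close>
  define e1 where "e1 = ln (Gamma (r / 2)) - (r / 2 * ln (r / 2) - r / 2)"
  define e2 where "e2 = ln (Gamma (m / 2)) - (m / 2 * ln (m / 2) - m / 2)"
  have "real (2 * k - d - 1) = r" "2 * k - d - 1 > 0"
    using adm by (auto simp: r_def excess_def admissible_def of_nat_diff)
  with Gamma_bounds_half_integer[of "2 * k - d - 1"]
  have e1: "- ln (r / 2) \<le> e1" "e1 \<le> 2" by (auto simp: e1_def)
  have "real (k - 1) = m" "k - 1 > 0" using m by (auto simp: m_def of_nat_diff)
  with Gamma_bounds_half_integer[of "k - 1"]
  have e2: "- ln (m / 2) \<le> e2" "e2 \<le> 2" by (auto simp: e2_def)
  have e: "\<bar>e1 - e2\<bar> \<le> 4 + 2 * ln m"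
  proof -
    have "ln (r / 2) = ln r - ln 2" "ln (m / 2) = ln m - ln 2" using r m by (auto simp: ln_div)
    moreover have "ln 2 > (0 :: real)" by simp
    ultimately show ?thesis using e1 e2 lr by linarith
  qed
  have s: "(real d - real k) / 2 = (m - r) / 2" using dm km by simp
  have v: "ln (levy_variance d k) = (m - r) / 2 * ln pi + (r / 2 * (ln r - ln 2 - 1))
      - m / 2 * (ln m - ln 2 - 1) + (e1 - e2)"
    unfolding ln_levy_variance[OF adm] r_def[symmetric] m_def[symmetric] s e1_def e2_def
    using r m by (simp add: ln_div algebra_simps)
  have dk: "real d / real k = 2 - (r + 1) / (m + 1)"
    using m by (simp add: dm km field_simps)
  define b where "b = (m - r) / (m * (m + 1))"
  have "b = (m - r) / (m + 1) / m" by (simp add: b_def mult.commute)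
  also have "\<dots> \<le> 1 / m" using m r by (intro divide_right_mono) auto
  finally have b: "b \<le> 1 / m" "0 \<le> b" using m rm by (auto simp: b_def)
  have beq: "r / m - (r + 1) / (m + 1) = - b" using m by (simp add: b_def divide_simps) (simp add: algebra_simps)
  have "log_threshold d k c - (ln (exp 1 * pi) - ln (critical_ratio d k)) / 2 =
      (ln 2 + ln m - ln d) / 2 + ln r / 2 * (r / m - (r + 1) / (m + 1)) + (ln c + (e1 - e2)) / m
      - (1 + ln 2 + ln pi) / 2 * (r / m)"
    unfolding log_threshold_def ln_critical_ratio(2)[OF adm] v r_def[symmetric] m_def[symmetric] dk
    using m by (simp add: ln_mult) (simp add: diff_divide_distrib add_divide_distrib algebra_simps)
  also have "(ln 2 + ln m - ln d) / 2 = ln (2 * m / d) / 2"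
    using m d by (simp add: ln_mult ln_div)
  also have "\<bar>ln (2 * m / d) / 2 + ln r / 2 * (r / m - (r + 1) / (m + 1)) + (ln c + (e1 - e2)) / m
      - (1 + ln 2 + ln pi) / 2 * (r / m)\<bar> \<le>
      \<bar>ln (2 * m / d)\<bar> / 2 + ln m / m + (\<bar>ln c\<bar> + (4 + 2 * ln m)) / m + (1 + ln 2 + ln pi) / 2 * (r / m)"
  proof -
    have 1: "\<bar>ln r / 2 * (r / m - (r + 1) / (m + 1))\<bar> \<le> ln m / m"
    proof -
      have "ln r / 2 * b \<le> ln m * (1 / m)" using b lr m by (intro mult_mono) auto
      then show ?thesis unfolding beq using b lr by (simp add: abs_mult)
    qed
    have 2: "\<bar>(ln c + (e1 - e2)) / m\<bar> \<le> (\<bar>ln c\<bar> + (4 + 2 * ln m)) / m"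
      using e m by (simp add: divide_right_mono)
    have 3: "\<bar>(1 + ln 2 + ln pi) / 2 * (r / m)\<bar> = (1 + ln 2 + ln pi) / 2 * (r / m)"
      using m r pi_ge_two by simp
    show ?thesis using 1 2 3 by linarith
  qed
  also have "\<dots> = \<bar>ln (2 * m / d)\<bar> / 2 + (\<bar>ln c\<bar> + 4 + 3 * ln m) / m + (1 + ln 2 + ln pi) / 2 * (r / m)"
    by (simp add: add_divide_distrib)
  finally show ?thesis .
qed

section \<open>Concentration of the size-biased measure\<close>

text \<open>Little is lost by bounding the factor \<open>(m - r) / (m + 2)\<close> of the variance by \<open>1\<close>, because \<open>r\<close> is small
  compared with \<open>m\<close> in the regime \<open>k / d \<longlonglongrightarrow> 1 / 2\<close>.\<close>

lemma size_biased_Chebyshev: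
  assumes adm: "admissible d k" and a: "a > 0" and E: "E \<in> sets borel"
    and far: "\<And>x. x \<in> E \<Longrightarrow> 0 < x \<Longrightarrow> a \<le> \<bar>x powr (2 / (real k - 1)) - excess d k / (real k - 1)\<bar>"
  shows "measure (size_biased d k) E \<le> 2 * excess d k / ((real k - 1)\<^sup>2 * a\<^sup>2)"
proof -
  interpret prob_space "size_biased d k" by (rule prob_space_size_biased[OF adm])
  define m where "m = real k - 1"
  define r where "r = excess d k"
  have m: "m \<ge> 2" and r: "r \<ge> 1" using admissibleD[OF adm] by (auto simp: m_def r_def)
  note gap = size_biased_variance_and_inverse_mean(1)[OF adm, folded m_def r_def]
  have "measure (size_biased d k) E = (\<integral>x. indicator E x \<partial>size_biased d k)"
    using E by simp
  also have "\<dots> \<le> (\<integral>x. (x powr (2 / m) - r / m)\<^sup>2 / a\<^sup>2 \<partial>size_biased d k)"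
  proof (rule integral_mono_AE)
    show "AE x in size_biased d k. indicator E x \<le> (x powr (2 / m) - r / m)\<^sup>2 / a\<^sup>2"
      using size_biased_AE
    proof eventually_elim
      case (elim x)
      show ?case
      proof (cases "x \<in> E")
        case True
        then have "a \<le> \<bar>x powr (2 / m) - r / m\<bar>" using far elim by (simp add: m_def r_def)
        then have "a\<^sup>2 \<le> (x powr (2 / m) - r / m)\<^sup>2"
          using a by (simp add: abs_le_square_iff[symmetric])
        then show ?thesis using True a by simp
      qed simp
    qed
  qed (use gap E in \<open>auto simp: has_bochner_integral_iff emeasure_eq_measure\<close>)
  also have "\<dots> = 2 * r * (m - r) / (m\<^sup>2 * (m + 2)) / a\<^sup>2"
    using gap by (simp add: has_bochner_integral_iff)
  also have "\<dots> = 2 * r / (m\<^sup>2 * a\<^sup>2) * ((m - r) / (m + 2))"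
    by (simp add: ac_simps)
  also have "\<dots> \<le> 2 * r / (m\<^sup>2 * a\<^sup>2) * 1"
    using m r by (intro mult_left_mono) auto
  finally show ?thesis by (simp add: m_def r_def)
qed

lemma exp_log_threshold:
  assumes adm: "admissible d k" and c: "c > 0"
  shows "(sqrt c * sqrt (levy_variance d k)) powr (2 / (real k - 1)) =
    excess d k / (real k - 1) * exp (log_threshold d k c)"
proof -
  note A = admissibleD[OF adm] and v = levy_variance_pos[OF adm]
  have "ln (sqrt c * sqrt (levy_variance d k)) = (ln c + ln (levy_variance d k)) / 2"
    using v c by (simp add: ln_mult ln_sqrt)
  then have "(sqrt c * sqrt (levy_variance d k)) powr (2 / (real k - 1)) =
     exp ((ln c + ln (levy_variance d k)) / (real k - 1))"
    using v c by (simp add: powr_def)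
  also have "\<dots> = excess d k / (real k - 1) * exp (log_threshold d k c)"
    using A unfolding log_threshold_def by (simp add: exp_add exp_diff)
  finally show ?thesis .
qed

text \<open>The threshold is \<open>w\<close> times the mean \<open>r / m\<close> of the Beta variable, where \<open>w\<close> is the exponential of
  \<open>log_threshold\<close>, so Chebyshev's inequality applies at distance \<open>r / m * (w - 1)\<close> or \<open>r / m * (1 - w)\<close>.\<close>

lemma size_biased_tails:
  assumes adm: "admissible d k" and c: "c > 0"
  shows "log_threshold d k c > 0 \<Longrightarrow>
      measure (size_biased d k) {x. sqrt c * sqrt (levy_variance d k) < x} \<le>
      2 / (excess d k * (exp (log_threshold d k c) - 1)\<^sup>2)"
    and "log_threshold d k c < 0 \<Longrightarrow>
      measure (size_biased d k) {x. x \<le> sqrt c * sqrt (levy_variance d k)} \<le>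
      2 / (excess d k * (1 - exp (log_threshold d k c))\<^sup>2)"
proof -
  define m where "m = real k - 1"
  define r where "r = excess d k"
  define w where "w = exp (log_threshold d k c)"
  define y where "y = sqrt c * sqrt (levy_variance d k)"
  have m: "m \<ge> 2" and r: "r \<ge> 1" using admissibleD[OF adm] by (auto simp: m_def r_def)
  have y: "y > 0" using c levy_variance_pos[OF adm] by (simp add: y_def)
  have yw: "y powr (2 / m) = r / m * w"
    using exp_log_threshold[OF adm c] by (simp add: m_def r_def w_def y_def)
  have val: "2 * r / (m\<^sup>2 * (r / m * b)\<^sup>2) = 2 / (r * b\<^sup>2)" for b
    using m r by (simp add: power2_eq_square)
  show "measure (size_biased d k) {x. sqrt c * sqrt (levy_variance d k) < x} \<le>
      2 / (excess d k * (exp (log_threshold d k c) - 1)\<^sup>2)" if "log_threshold d k c > 0"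
  proof -
    have w: "w > 1" using that by (simp add: w_def)
    have "measure (size_biased d k) {x. y < x} \<le> 2 * r / (m\<^sup>2 * (r / m * (w - 1))\<^sup>2)"
      proof (rule size_biased_Chebyshev[OF adm, folded r_def m_def])
      show "r / m * (w - 1) > 0" using m r w by simp
      fix x assume "x \<in> {x. y < x}" "0 < x"
      then have "y powr (2 / m) \<le> x powr (2 / m)" using y m by (intro powr_mono2) auto
      then show "r / m * (w - 1) \<le> \<bar>x powr (2 / m) - r / m\<bar>" by (simp add: yw algebra_simps diff_divide_distrib)
    qed simp
    note this[unfolded val]
    then show ?thesis by (simp only: y_def r_def w_def)
  qed
  show "measure (size_biased d k) {x. x \<le> sqrt c * sqrt (levy_variance d k)} \<le>
      2 / (excess d k * (1 - exp (log_threshold d k c))\<^sup>2)" if "log_threshold d k c < 0"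
  proof -
    have w: "w < 1" using that by (simp add: w_def)
    have "measure (size_biased d k) {x. x \<le> y} \<le> 2 * r / (m\<^sup>2 * (r / m * (1 - w))\<^sup>2)"
      proof (rule size_biased_Chebyshev[OF adm, folded r_def m_def])
      show "r / m * (1 - w) > 0" using m r w by simp
      fix x assume "x \<in> {x. x \<le> y}" "0 < x"
      then have "x powr (2 / m) \<le> y powr (2 / m)" using y m by (intro powr_mono2) auto
      then show "r / m * (1 - w) \<le> \<bar>x powr (2 / m) - r / m\<bar>" by (simp add: yw algebra_simps diff_divide_distrib)
    qed simp
    note this[unfolded val]
    then show ?thesis by (simp only: y_def r_def w_def)
  qed
qed

text \<open>Markov's inequality for \<open>1 / Y - 1\<close> with \<open>Y = x powr (2 / m)\<close>: below the threshold this is at least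
  \<open>(c v) powr (- 1 / m) - 1 \<ge> - ln (c v) / m\<close>.\<close>

lemma size_biased_lower_tail:
  assumes adm: "admissible d k" and c: "c > 0" and r: "excess d k > 2"
    and T: "ln c + ln (levy_variance d k) < 0"
  shows "measure (size_biased d k) {x. x \<le> sqrt c * sqrt (levy_variance d k)} \<le>
     (real d - real k) * (real k - 1) / ((excess d k - 2) * - (ln c + ln (levy_variance d k)))"
proof -
  interpret prob_space "size_biased d k" by (rule prob_space_size_biased[OF adm])
  define m where "m = real k - 1"
  define t where "t = - (ln c + ln (levy_variance d k))"
  define y where "y = sqrt c * sqrt (levy_variance d k)"
  note A = admissibleD[OF adm]
  have m: "m \<ge> 2" using A by (auto simp: m_def)
  have t: "t > 0" using T by (simp add: t_def)
  have y: "y > 0" using c levy_variance_pos[OF adm] by (simp add: y_def)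
  note inv = size_biased_variance_and_inverse_mean(2)[OF adm r, folded m_def]
  have "ln y = - t / 2"
    using c levy_variance_pos[OF adm] by (simp add: y_def t_def ln_mult ln_sqrt)
  then have "y powr (- 2 / m) = exp (t / m)" using y by (simp add: powr_def)
  also have "\<dots> \<ge> 1 + t / m" by (rule exp_ge_add_one_self)
  finally have ym: "y powr (- 2 / m) \<ge> 1 + t / m" .
  have meas: "{x. x \<le> y} \<in> sets (size_biased d k)" by simp
  have "measure (size_biased d k) {x. x \<le> y} = (\<integral>x. indicator {x. x \<le> y} x \<partial>size_biased d k)"
    using meas by simp
  also have "\<dots> \<le> (\<integral>x. (x powr (- 2 / m) - 1) / (t / m) \<partial>size_biased d k)"
  proof (rule integral_mono_AE)
    show "AE x in size_biased d k. indicator {x. x \<le> y} x \<le> (x powr (- 2 / m) - 1) / (t / m)"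
      using size_biased_AE
    proof eventually_elim
      case (elim x)
      show ?case
      proof (cases "x \<le> y")
        case True
        then have "y powr (- 2 / m) \<le> x powr (- 2 / m)" using elim m by (intro powr_mono2') auto
        then have "t / m \<le> x powr (- 2 / m) - 1" using ym by simp
        moreover have "t / m > 0" using t m by simp
        ultimately have "1 \<le> (x powr (- 2 / m) - 1) / (t / m)"
          by (simp only: le_divide_eq_1_pos)
        moreover have "indicator {x. x \<le> y} x = (1 :: real)" using True by simp
        ultimately show ?thesis by (simp only:)
      next
        case False
        have "1 powr (- 2 / m) \<le> x powr (- 2 / m)" using elim m by (intro powr_mono2') auto
        then show ?thesis using False t m by simp
      qed
    qed
  qed (use inv meas in \<open>auto simp: has_bochner_integral_iff emeasure_eq_measure\<close>)
  also have "\<dots> = ((m - 2) / (excess d k - 2) - 1) / (t / m)"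
    using inv prob_space by (simp add: has_bochner_integral_iff)
  also have "(m - 2) / (excess d k - 2) - 1 = (real d - real k) / (excess d k - 2)"
    using r A(4) by (simp add: m_def field_simps)
  finally show ?thesis by (simp add: y_def t_def m_def)
qed

section \<open>The two regimes along a sequence\<close>

locale admissible_sequence =
  fixes d k :: "nat \<Rightarrow> nat"
  assumes adm: "\<And>n. admissible (d n) (k n)"
    and d_lim: "filterlim d at_top sequentially"
begin

lemma real_d_lim: "filterlim (\<lambda>n. real (d n)) at_top sequentially"
  by (rule filterlim_compose[OF filterlim_real_sequentially d_lim])

lemma k_minus_1_ge: "real (k n) - 1 \<ge> real (d n) / 2"
  using adm[of n] by (auto simp: admissible_def)

lemma d_pos: "real (d n) > 0"
  using admissibleD(1,2)[OF adm[of n]] by linarith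

lemma k_minus_1_lim: "filterlim (\<lambda>n. real (k n) - 1) at_top sequentially"
proof (rule filterlim_at_top_mono)
  show "filterlim (\<lambda>n. real (d n) / 2) at_top sequentially"
    by (rule filterlim_compose[OF _ real_d_lim]) real_asymp
qed (use k_minus_1_ge in auto)

lemma inverse_d_lim: "(\<lambda>n. 1 / real (d n)) \<longlonglongrightarrow> 0"
  by (rule filterlim_compose[OF _ real_d_lim]) real_asymp

lemma log_threshold_limit:
  assumes half: "(\<lambda>n. real (k n) / real (d n)) \<longlonglongrightarrow> 1 / 2"
  shows "(\<lambda>n. log_threshold (d n) (k n) c
      - (ln (exp 1 * pi) - ln (critical_ratio (d n) (k n))) / 2) \<longlonglongrightarrow> 0"
    and "(\<lambda>n. excess (d n) (k n) / real (d n)) \<longlonglongrightarrow> 0"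
proof -
  let ?m = "\<lambda>n. real (k n) - 1"
  let ?r = "\<lambda>n. excess (d n) (k n)"
  have "(\<lambda>n. real (k n) / real (d n) - 1 / real (d n)) \<longlonglongrightarrow> 1 / 2 - 0"
    by (intro tendsto_diff half inverse_d_lim)
  then have md: "(\<lambda>n. ?m n / real (d n)) \<longlonglongrightarrow> 1 / 2"
    by (simp add: diff_divide_distrib)
  have "(\<lambda>n. 2 * (real (k n) / real (d n)) - 1 - 1 / real (d n)) \<longlonglongrightarrow> 2 * (1 / 2) - 1 - 0"
    by (intro tendsto_diff tendsto_mult half inverse_d_lim tendsto_const)
  moreover have "2 * (real (k n) / real (d n)) - 1 - 1 / real (d n) = ?r n / real (d n)" for n
    using d_pos[of n] by (simp add: excess_def diff_divide_distrib)
  ultimately show rd: "(\<lambda>n. ?r n / real (d n)) \<longlonglongrightarrow> 0" by simp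
  have "(\<lambda>n. (?r n / real (d n)) / (?m n / real (d n))) \<longlonglongrightarrow> 0 / (1 / 2)"
    by (intro tendsto_divide rd md) simp
  moreover have "(?r n / real (d n)) / (?m n / real (d n)) = ?r n / ?m n" for n
    using d_pos[of n] by simp
  ultimately have rm: "(\<lambda>n. ?r n / ?m n) \<longlonglongrightarrow> 0" by (simp only: div_0)
  have "(\<lambda>n. ln (2 * (?m n / real (d n)))) \<longlonglongrightarrow> ln (2 * (1 / 2))"
    by (intro tendsto_ln tendsto_mult tendsto_const md) simp
  then have l: "(\<lambda>n. ln (2 * ?m n / real (d n))) \<longlonglongrightarrow> 0" by simp
  have "((\<lambda>x. (\<bar>ln c\<bar> + 4 + 3 * ln x) / x) \<longlongrightarrow> 0) at_top" by real_asymp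
  from filterlim_compose[OF this k_minus_1_lim]
  have lm: "(\<lambda>n. (\<bar>ln c\<bar> + 4 + 3 * ln (?m n)) / ?m n) \<longlonglongrightarrow> 0" .
  have "(\<lambda>n. \<bar>ln (2 * ?m n / real (d n))\<bar> / 2 + (\<bar>ln c\<bar> + 4 + 3 * ln (?m n)) / ?m n
      + (1 + ln 2 + ln pi) / 2 * (?r n / ?m n)) \<longlonglongrightarrow> \<bar>0\<bar> / 2 + 0 + (1 + ln 2 + ln pi) / 2 * 0"
    by (intro tendsto_add tendsto_mult tendsto_divide tendsto_rabs tendsto_const l lm rm) simp
  then have lim: "(\<lambda>n. \<bar>ln (2 * ?m n / real (d n))\<bar> / 2 + (\<bar>ln c\<bar> + 4 + 3 * ln (?m n)) / ?m n
      + (1 + ln 2 + ln pi) / 2 * (?r n / ?m n)) \<longlonglongrightarrow> 0" by simp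
  show "(\<lambda>n. log_threshold (d n) (k n) c
      - (ln (exp 1 * pi) - ln (critical_ratio (d n) (k n))) / 2) \<longlonglongrightarrow> 0"
    by (rule Lim_null_comparison[OF always_eventually lim])
       (use log_threshold_approx[OF adm] in simp)
qed

text \<open>If \<open>r\<close> is bounded, Chebyshev's bound \<open>2 / (r (w - 1)\<^sup>2)\<close> is small only because \<open>w\<close> is large. Both cases
  are covered at once: \<open>w - 1\<close> is at least a fixed fraction of \<open>w\<close>, and \<open>r w\<^sup>2 \<ge> d / r\<close>, which tends to
  infinity.\<close>

lemma Gaussian_tail:
  assumes half: "(\<lambda>n. real (k n) / real (d n)) \<longlonglongrightarrow> 1 / 2"
    and q: "q > 0" "q < exp 1 * pi" "eventually (\<lambda>n. critical_ratio (d n) (k n) < q) sequentially"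
    and h: "h > 0"
  shows "(\<lambda>n. measure (size_biased (d n) (k n)) {x. h * sqrt (levy_variance (d n) (k n)) < x}) \<longlonglongrightarrow> 0"
proof -
  define \<eta> where "\<eta> = ln (exp 1 * pi) - ln q"
  have \<eta>: "\<eta> > 0" using q(1,2) by (simp add: \<eta>_def)
  \<comment> \<open>A lower bound for \<open>ln w\<close>, and also the tolerance for \<open>ln w - H / 2\<close>; at most \<open>1 / 2\<close>, so that the
    error \<open>2 g\<close> is absorbed by \<open>ln (e pi) \<ge> 1\<close>.\<close>
  define g where "g = min (\<eta> / 4) (1 / 2)"
  have g: "g > 0" "g \<le> \<eta> / 4" "g \<le> 1 / 2" using \<eta> by (auto simp: g_def)
  define C where "C = 2 / (1 - exp (- g))\<^sup>2"
  let ?G = "\<lambda>n. log_threshold (d n) (k n) (h\<^sup>2)"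
  let ?H = "\<lambda>n. ln (exp 1 * pi) - ln (critical_ratio (d n) (k n))"
  have "\<forall>\<^sub>F n in sequentially. dist (?G n - ?H n / 2) 0 < g"
    using log_threshold_limit(1)[OF half] g(1) by (rule tendstoD)
  with q(3) have "\<forall>\<^sub>F n in sequentially.
      norm (measure (size_biased (d n) (k n)) {x. h * sqrt (levy_variance (d n) (k n)) < x})
      \<le> C * (excess (d n) (k n) / real (d n))"
  proof eventually_elim
    case (elim n)
    define r where "r = excess (d n) (k n)"
    define G where "G = ?G n"
    have r: "r \<ge> 1" and k: "real (k n) > 0" and d: "real (d n) > 0"
      using admissibleD[OF adm[of n]] by (auto simp: r_def)
    have "ln (critical_ratio (d n) (k n)) \<le> ln q"
      using elim(1) ln_critical_ratio(1)[OF adm[of n]] by simp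
    define H where "H = ?H n"
    have H: "H \<ge> \<eta>" using \<open>ln (critical_ratio (d n) (k n)) \<le> ln q\<close> by (simp add: \<eta>_def H_def)
    have "\<bar>G - H / 2\<bar> < g" using elim(2) by (simp only: G_def H_def dist_real_def diff_0_right)
    then have GH: "G \<ge> H / 2 - g" by linarith
    have Gg: "G \<ge> g" using GH H g by linarith
    have dk: "real (d n) / real (k n) \<le> 2"
      using adm[of n] k by (simp add: field_simps admissible_def)
    have "real (d n) / real (k n) * ln r \<le> 2 * ln r"
      using dk r by (intro mult_right_mono) auto
    then have "H \<ge> ln (exp 1 * pi) + ln (real (d n)) - 2 * ln r"
      using ln_critical_ratio(2)[OF adm[of n]] by (simp add: r_def H_def)
    moreover have "ln (exp 1 * pi) \<ge> 1" using pi_ge_two by (simp add: ln_mult)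
    ultimately have "2 * G + ln r \<ge> ln (real (d n)) - ln r"
      using GH g(3) by linarith
    then have "exp (ln (real (d n)) - ln r) \<le> exp (2 * G + ln r)" by simp
    then have "real (d n) / r \<le> (exp G)\<^sup>2 * r"
      using r d by (simp add: exp_diff exp_add exp_double)
    then have rw: "real (d n) / r \<le> r * (exp G)\<^sup>2" by (simp only: mult.commute)
    have "exp G - 1 = exp G * (1 - exp (- G))" by (simp add: right_diff_distrib flip: exp_add)
    also have "\<dots> \<ge> exp G * (1 - exp (- g))" using Gg by (intro mult_left_mono) auto
    finally have "(exp G * (1 - exp (- g)))\<^sup>2 \<le> (exp G - 1)\<^sup>2"
      using g by (intro power_mono) auto
    then have "real (d n) / r * (1 - exp (- g))\<^sup>2 \<le> r * (exp G - 1)\<^sup>2"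
    proof -
      have "real (d n) / r * (1 - exp (- g))\<^sup>2 \<le> r * (exp G)\<^sup>2 * (1 - exp (- g))\<^sup>2"
        using rw by (intro mult_right_mono) auto
      also have "\<dots> = r * (exp G * (1 - exp (- g)))\<^sup>2" by (simp add: power_mult_distrib)
      also have "\<dots> \<le> r * (exp G - 1)\<^sup>2"
        using \<open>(exp G * (1 - exp (- g)))\<^sup>2 \<le> (exp G - 1)\<^sup>2\<close> r by (intro mult_left_mono) auto
      finally show ?thesis .
    qed
    then have "2 / (r * (exp G - 1)\<^sup>2) \<le> 2 / (real (d n) / r * (1 - exp (- g))\<^sup>2)"
      using g r d by (intro frac_le) auto
    also have "\<dots> = C * (r / real (d n))" by (simp add: C_def)
    finally have "2 / (r * (exp G - 1)\<^sup>2) \<le> C * (r / real (d n))" .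
    moreover have "measure (size_biased (d n) (k n)) {x. h * sqrt (levy_variance (d n) (k n)) < x}
        \<le> 2 / (r * (exp G - 1)\<^sup>2)"
      using size_biased_tails(1)[OF adm[of n], of "h\<^sup>2"] h Gg g by (simp add: G_def r_def)
    ultimately show ?case by (simp add: r_def)
  qed
  moreover have "(\<lambda>n. C * (excess (d n) (k n) / real (d n))) \<longlonglongrightarrow> 0"
    using tendsto_mult_left[OF log_threshold_limit(2)[OF half], of C] by simp
  ultimately show ?thesis by (rule Lim_null_comparison)
qed

text \<open>Here \<open>r \<ge> sqrt d\<close>, because \<open>r powr (d / k) > d\<close> and \<open>d / k \<le> 2\<close>, so Chebyshev's bound vanishes while
  \<open>w\<close> stays away from \<open>1\<close>.\<close>

lemma degenerate_tail_critical:
  assumes half: "(\<lambda>n. real (k n) / real (d n)) \<longlonglongrightarrow> 1 / 2"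
    and q: "q > exp 1 * pi" "eventually (\<lambda>n. critical_ratio (d n) (k n) > q) sequentially"
    and B: "B > 0"
  shows "(\<lambda>n. measure (size_biased (d n) (k n)) {x. x \<le> B * sqrt (levy_variance (d n) (k n))}) \<longlonglongrightarrow> 0"
proof -
  have q0: "q > 0" using q(1) by (rule less_trans[rotated]) simp
  define \<eta> where "\<eta> = ln q - ln (exp 1 * pi)"
  have \<eta>: "\<eta> > 0" using q(1) q0 by (simp add: \<eta>_def)
  define g where "g = \<eta> / 4"
  have g: "g > 0" using \<eta> by (simp add: g_def)
  let ?G = "\<lambda>n. log_threshold (d n) (k n) (B\<^sup>2)"
  let ?H = "\<lambda>n. ln (exp 1 * pi) - ln (critical_ratio (d n) (k n))"
  have "\<forall>\<^sub>F n in sequentially. dist (?G n - ?H n / 2) 0 < g"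
    using log_threshold_limit(1)[OF half] g by (rule tendstoD)
  with q(2) have "\<forall>\<^sub>F n in sequentially.
      norm (measure (size_biased (d n) (k n)) {x. x \<le> B * sqrt (levy_variance (d n) (k n))})
      \<le> 2 / (sqrt (real (d n)) * (1 - exp (- g))\<^sup>2)"
  proof eventually_elim
    case (elim n)
    define r where "r = excess (d n) (k n)"
    define G where "G = ?G n"
    have r: "r \<ge> 1" and k: "real (k n) > 0" and d: "real (d n) > 0"
      using admissibleD[OF adm[of n]] by (auto simp: r_def)
    have "ln (critical_ratio (d n) (k n)) \<ge> ln q"
      using elim(1) q0 by simp
    define H where "H = ?H n"
    have H: "H \<le> - \<eta>" using \<open>ln (critical_ratio (d n) (k n)) \<ge> ln q\<close> by (simp add: \<eta>_def H_def)
    have "\<bar>G - H / 2\<bar> < g" using elim(2) by (simp only: G_def H_def dist_real_def diff_0_right)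
    then have Gg: "G \<le> - g" using H unfolding g_def by linarith
    have dk: "real (d n) / real (k n) \<le> 2"
      using adm[of n] k by (simp add: field_simps admissible_def)
    have "real (d n) / real (k n) * ln r \<le> 2 * ln r"
      using dk r by (intro mult_right_mono) auto
    moreover have "real (d n) / real (k n) * ln r - ln (real (d n)) \<ge> 0"
    proof -
      have "ln (exp 1 * pi) \<ge> 1" using pi_ge_two by (simp add: ln_mult)
      then show ?thesis using H \<eta> ln_critical_ratio(2)[OF adm[of n]] by (simp add: r_def H_def)
    qed
    ultimately have "ln (sqrt (real (d n))) \<le> ln r" using d by (simp add: ln_sqrt)
    then have rd: "sqrt (real (d n)) \<le> r" using d r by simp
    have "2 / (r * (1 - exp G)\<^sup>2) \<le> 2 / (sqrt (real (d n)) * (1 - exp (- g))\<^sup>2)"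
      using rd Gg g d r by (intro frac_le mult_mono power_mono mult_pos_pos) auto
    moreover have "measure (size_biased (d n) (k n)) {x. x \<le> B * sqrt (levy_variance (d n) (k n))}
        \<le> 2 / (r * (1 - exp G)\<^sup>2)"
      using size_biased_tails(2)[OF adm[of n], of "B\<^sup>2"] B Gg g by (simp add: G_def r_def)
    ultimately show ?case by simp
  qed
  moreover have "((\<lambda>x. 2 / (sqrt x * (1 - exp (- g))\<^sup>2)) \<longlongrightarrow> 0) at_top"
  proof -
    have "(1 - exp (- g))\<^sup>2 > 0" using g by simp
    then show ?thesis by real_asymp
  qed
  note filterlim_compose[OF this real_d_lim]
  ultimately show ?thesis by (rule Lim_null_comparison)
qed

text \<open>Now \<open>r - 2\<close> is at least a fixed fraction of \<open>m\<close>, and \<open>- ln (c v)\<close> eventually exceeds any multiple of \<open>d - k\<close>, so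
  in the Markov bound both \<open>d - k\<close> and \<open>m\<close> cancel and a factor of order \<open>1 / ln m\<close> remains.\<close>

lemma degenerate_tail_supercritical:
  assumes q: "q > 1 / 2" "eventually (\<lambda>n. real (k n) / real (d n) > q) sequentially"
    and B: "B > 0"
  shows "(\<lambda>n. measure (size_biased (d n) (k n)) {x. x \<le> B * sqrt (levy_variance (d n) (k n))}) \<longlonglongrightarrow> 0"
proof -
  define \<theta> where "\<theta> = 2 - 1 / q"
  have \<theta>: "\<theta> > 0" using q(1) by (simp add: \<theta>_def field_simps)
  \<comment> \<open>A lower bound for \<open>ln ((r - 2) / (2 pi))\<close> in terms of \<open>m\<close>.\<close>
  define L where "L = (\<lambda>m. ln (\<theta> * m / 2 / (2 * pi)))"
  have "filterlim L at_top at_top" unfolding L_def using \<theta> by real_asymp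
  then have L_lim: "filterlim (\<lambda>n. L (real (k n) - 1)) at_top sequentially"
    by (rule filterlim_compose[OF _ k_minus_1_lim])
  have "\<forall>\<^sub>F n in sequentially. L (real (k n) - 1) \<ge> 4 * \<bar>ln (B\<^sup>2)\<bar> + 1"
    using L_lim by (simp add: filterlim_at_top)
  moreover have "\<forall>\<^sub>F n in sequentially. real (k n) - 1 \<ge> 6 / \<theta>"
    using k_minus_1_lim by (simp add: filterlim_at_top)
  ultimately have "\<forall>\<^sub>F n in sequentially.
      norm (measure (size_biased (d n) (k n)) {x. x \<le> B * sqrt (levy_variance (d n) (k n))})
      \<le> 8 / (\<theta> * L (real (k n) - 1))"
    using q(2)
  proof eventually_elim
    case (elim n)
    define r where "r = excess (d n) (k n)"
    define m where "m = real (k n) - 1"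
    define s where "s = (real (d n) - real (k n)) / 2"
    define c where "c = ln (B\<^sup>2)"
    define T where "T = - (c + ln (levy_variance (d n) (k n)))"
    note A = admissibleD[OF adm[of n]]
    have m: "m \<ge> 2" and s: "s \<ge> 1 / 2" and d: "real (d n) > 0"
      using A by (auto simp: m_def s_def)
    have L1: "L m \<ge> 4 * \<bar>c\<bar> + 1" using elim(1) by (simp add: m_def c_def)
    have \<theta>m: "\<theta> * m \<ge> 6" using elim(2) \<theta> by (simp add: m_def field_simps)
    have "real (d n) \<le> real (k n) / q"
      using elim(3) q(1) d by (simp add: field_simps)
    then have "r - 2 \<ge> \<theta> * real (k n) - 3"
      by (simp add: r_def excess_def \<theta>_def algebra_simps)
    moreover have "\<theta> * real (k n) \<ge> \<theta> * m" using \<theta> by (simp add: m_def)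
    ultimately have r: "r - 2 \<ge> \<theta> * m / 2" using \<theta>m by linarith
    then have r2: "r > 2" using \<theta>m by linarith
    have "L m \<le> ln ((r - 2) / (2 * pi))"
    proof -
      have "\<theta> * m / 2 / (2 * pi) \<le> (r - 2) / (2 * pi)" using r by (intro divide_right_mono) auto
      moreover have "\<theta> * m / 2 / (2 * pi) > 0" using \<theta> m by simp
      ultimately show ?thesis unfolding L_def by (subst ln_le_cancel_iff) linarith+
    qed
    then have "s * L m \<le> s * ln ((r - 2) / (2 * pi))" using s by (intro mult_left_mono) auto
    moreover have "ln (levy_variance (d n) (k n)) \<le> - s * ln ((r - 2) / (2 * pi))"
      using ln_levy_variance_le[OF adm[of n] r2[unfolded r_def]]
      by (simp only: r_def s_def minus_divide_left)
    ultimately have "T \<ge> s * L m - c" by (simp add: T_def)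
    \<comment> \<open>\<open>s \<ge> 1 / 2\<close> makes \<open>s * L m\<close> dominate the constant \<open>c\<close>.\<close>
    moreover have "s * L m \<ge> 1 / 2 * L m" using s L1 by (intro mult_right_mono) auto
    ultimately have T: "T \<ge> s * L m / 2" using L1 by linarith
    have sL: "s * L m > 0" using s L1 by (intro mult_pos_pos) auto
    have neg: "ln (B\<^sup>2) + ln (levy_variance (d n) (k n)) < 0"
      using T sL by (simp add: T_def c_def)
    have s2: "real (d n) - real (k n) = 2 * s" by (simp add: s_def)
    have "measure (size_biased (d n) (k n)) {x. x \<le> B * sqrt (levy_variance (d n) (k n))}
        \<le> (real (d n) - real (k n)) * (real (k n) - 1) /
          ((excess (d n) (k n) - 2) * - (ln (B\<^sup>2) + ln (levy_variance (d n) (k n))))"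
      using size_biased_lower_tail[OF adm[of n] _ r2[unfolded r_def] neg] B by simp
    also have "\<dots> = (2 * s) * m / ((r - 2) * T)"
      by (simp only: s2 m_def r_def T_def c_def)
    also have "\<dots> \<le> (2 * s) * m / ((\<theta> * m / 2) * (s * L m / 2))"
      using r r2 T s m sL \<theta> by (intro frac_le mult_mono mult_pos_pos) auto
    also have "\<dots> = 8 / (\<theta> * L m)" using s m by simp
    finally show ?case by (simp add: m_def)
  qed
  moreover have "((\<lambda>x. 8 / (\<theta> * x)) \<longlongrightarrow> 0) at_top" using \<theta> by real_asymp
  note filterlim_compose[OF this L_lim]
  ultimately show ?thesis by (rule Lim_null_comparison)
qed

lemma size_biased_pos: "AE x in size_biased (d n) (k n). x > 0"
  using size_biased_AE by eventually_elim simp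

lemma converges_to_Gaussian:
  assumes Z: "\<And>n. is_Z (M n) (Z n) (d n) (k n)"
    and lim: "\<And>h. h > 0 \<Longrightarrow> (\<lambda>n. measure (size_biased (d n) (k n)) {x. h * sqrt (levy_variance (d n) (k n)) < x}) \<longlonglongrightarrow> 0"
  shows "converges_in_distribution M (\<lambda>n. variance_normalized (M n) (Z n)) std_normal_distribution"
proof (rule converges_in_distribution_from_exponent[OF Z adm])
  show "real_distribution std_normal_distribution" by (rule real_dist_normal_dist)
  show "char std_normal_distribution t = exp (- complex_of_real (t\<^sup>2 / 2))" for t
    by (simp add: char_std_normal_distribution exp_of_real[symmetric])
  show "(\<lambda>n. \<integral>x. levy_kernel t (x / sqrt (levy_variance (d n) (k n))) \<partial>size_biased (d n) (k n))
      \<longlonglongrightarrow> - complex_of_real (t\<^sup>2 / 2)" for t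
    by (rule levy_kernel_gaussian_limit)
       (auto intro: prob_space_size_biased adm size_biased_pos lim levy_variance_pos)
qed

lemma converges_to_0:
  assumes Z: "\<And>n. is_Z (M n) (Z n) (d n) (k n)"
    and lim: "\<And>B. B > 0 \<Longrightarrow> (\<lambda>n. measure (size_biased (d n) (k n)) {x. x \<le> B * sqrt (levy_variance (d n) (k n))}) \<longlonglongrightarrow> 0"
  shows "converges_in_distribution M (\<lambda>n. variance_normalized (M n) (Z n)) (return borel 0)"
proof (rule converges_in_distribution_from_exponent[OF Z adm])
  show "real_distribution (return borel (0 :: real))"
    by (simp add: real_distribution_def real_distribution_axioms_def prob_space_return)
  show "char (return borel (0 :: real)) t = exp 0" for t
    by (simp add: char_def integral_return)
  show "(\<lambda>n. \<integral>x. levy_kernel t (x / sqrt (levy_variance (d n) (k n))) \<partial>size_biased (d n) (k n))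
      \<longlonglongrightarrow> 0" for t
    by (rule levy_kernel_degenerate_limit)
       (auto intro: prob_space_size_biased adm size_biased_pos lim levy_variance_pos)
qed

end

theorem theorem1:
  fixes d k :: "nat \<Rightarrow> nat"
    and M :: "nat \<Rightarrow> 'a measure"
    and Z :: "nat \<Rightarrow> 'a \<Rightarrow> real"
    and r :: "nat \<Rightarrow> real"
  assumes k_pos: "\<And>n. 1 \<le> k n"
    and k_less_d: "\<And>n. k n < d n"
    and two_k_gt: "\<And>n. 2 * k n > d n + 1"
    and d_tendsto: "filterlim d at_top sequentially"
    and Z: "\<And>n. is_Z (M n) (Z n) (d n) (k n)"
    and r: "\<And>n. r n = 2 * real (k n) - real (d n) - 1"
  shows
    "((\<lambda>n. real (k n) / real (d n)) \<longlonglongrightarrow> 1 / 2 \<and>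
      limsup (\<lambda>n. ereal (r n powr (real (d n) / real (k n)) / real (d n))) < ereal (exp 1 * pi)
      \<longrightarrow> converges_in_distribution M (\<lambda>n. variance_normalized (M n) (Z n))
            std_normal_distribution)
   \<and> (((\<lambda>n. real (k n) / real (d n)) \<longlonglongrightarrow> 1 / 2 \<and>
       liminf (\<lambda>n. ereal (r n powr (real (d n) / real (k n)) / real (d n))) > ereal (exp 1 * pi))
      \<or> liminf (\<lambda>n. ereal (real (k n) / real (d n))) > ereal (1 / 2)
      \<longrightarrow> converges_in_distribution M (\<lambda>n. variance_normalized (M n) (Z n))
            (return borel 0))"
proof -
  interpret admissible_sequence d k
    using k_less_d two_k_gt d_tendsto by unfold_locales (auto simp: admissible_def)
  have ratio: "r n powr (real (d n) / real (k n)) / real (d n) = critical_ratio (d n) (k n)" for n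
    by (simp add: critical_ratio_def excess_def r)
  have less_limsup: "\<exists>q. q < a \<and> eventually (\<lambda>n. f n < q) sequentially"
    if "limsup (\<lambda>n. ereal (f n)) < ereal a" for f :: "nat \<Rightarrow> real" and a
  proof -
    from ereal_dense2[OF that] obtain q
      where q: "limsup (\<lambda>n. ereal (f n)) < ereal q" "ereal q < ereal a" by blast
    from Limsup_lessD[OF q(1)] q(2) show ?thesis by auto
  qed
  have less_liminf: "\<exists>q. q > a \<and> eventually (\<lambda>n. f n > q) sequentially"
    if "liminf (\<lambda>n. ereal (f n)) > ereal a" for f :: "nat \<Rightarrow> real" and a
  proof -
    from ereal_dense2[OF that] obtain q
      where q: "liminf (\<lambda>n. ereal (f n)) > ereal q" "ereal q > ereal a" by blast
    from less_LiminfD[OF q(1)] q(2) show ?thesis by auto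
  qed
  have a: "converges_in_distribution M (\<lambda>n. variance_normalized (M n) (Z n)) std_normal_distribution"
    if half: "(\<lambda>n. real (k n) / real (d n)) \<longlonglongrightarrow> 1 / 2"
      and sup: "limsup (\<lambda>n. ereal (critical_ratio (d n) (k n))) < ereal (exp 1 * pi)"
  proof -
    from less_limsup[OF sup] obtain q where q: "q < exp 1 * pi"
      and ev: "eventually (\<lambda>n. critical_ratio (d n) (k n) < q) sequentially" by auto
    obtain n where "critical_ratio (d n) (k n) < q"
      using ev by (auto simp: eventually_sequentially)
    then have "q > 0" using ln_critical_ratio(1)[OF adm[of n]] by simp
    then show ?thesis using Gaussian_tail[OF half _ q ev] by (intro converges_to_Gaussian Z) auto
  qed
  have b: "converges_in_distribution M (\<lambda>n. variance_normalized (M n) (Z n)) (return borel 0)"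
    if "(\<lambda>n. real (k n) / real (d n)) \<longlonglongrightarrow> 1 / 2 \<and>
       liminf (\<lambda>n. ereal (critical_ratio (d n) (k n))) > ereal (exp 1 * pi)
      \<or> liminf (\<lambda>n. ereal (real (k n) / real (d n))) > ereal (1 / 2)"
    using that
  proof (elim disjE conjE)
    assume half: "(\<lambda>n. real (k n) / real (d n)) \<longlonglongrightarrow> 1 / 2"
      and inf: "liminf (\<lambda>n. ereal (critical_ratio (d n) (k n))) > ereal (exp 1 * pi)"
    from less_liminf[OF inf] obtain q where "q > exp 1 * pi"
      "eventually (\<lambda>n. critical_ratio (d n) (k n) > q) sequentially" by auto
    from degenerate_tail_critical[OF half this] show ?thesis by (intro converges_to_0 Z)
  next
    assume "liminf (\<lambda>n. ereal (real (k n) / real (d n))) > ereal (1 / 2)"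
    from less_liminf[OF this] obtain q where "q > 1 / 2"
      "eventually (\<lambda>n. real (k n) / real (d n) > q) sequentially" by auto
    from degenerate_tail_supercritical[OF this] show ?thesis by (intro converges_to_0 Z)
  qed
  show ?thesis unfolding ratio using a b by blast
qed

end
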